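(* Consider a VarMiON $\widehat{\mathcal S}$ trained on the dataset $\mathbb S$ generated by samples $W=\{(f_j,\theta_j,\eta_j)\}_{j=1}^J\subset\mathcal X$ to approximate the solution operator $\mathcal S$. Assume the following. (1) (Stability of $\mathcal S$.) There is a constant $C_{\rm stab}$ (which may depend on $\Omega,\Gamma_\eta,\Gamma_g$) such that for all $(f,\theta,\eta),(f',\theta',\eta')\in\mathcal X$, $$\|\mathcal S(f,\theta,\eta)-\mathcal S(f',\theta',\eta')\|_{L^2(\Omega)}\le C_{\rm stab}\big(\|f-f'\|_{L^2(\Omega)}+\|\theta-\theta'\|_{L^2(\Omega)}+\|\eta-\eta'\|_{L^2(\Gamma_\eta)}\big).$$ (2) (Numerical error.) There is $\epsilon_h>0$ such that $\|\mathcal S(f,\theta,\eta)-\mathcal S^h(\mathcal P(f,\theta,\eta))\|_{L^2(\Omega)}<C_h(f,\theta,\eta)\,\epsilon_h$ for all $(f,\theta,\eta)\in\mathcal X$, where $C_h$ may depend on the data $(f,\theta,\eta)$. Put $C_{h,\mathbb S}=\max_{1\le j\le J}C_h(f_j,\theta_j,\eta_j)$. (3) (Covering.) $\mathcal X$ is compact, $\epsilon_s>0$ is given, and for every $(f,\theta,\eta)\in\mathcal X$ there is $1\le j\le J$ with $\|f-f_j\|_{L^2(\Omega)}<\epsilon_s$, $\|\theta-\theta_j\|_{L^2(\Omega)}<\epsilon_s$ and $\|\eta-\eta_j\|_{L^2(\Gamma_\eta)}<\epsilon_s$ (where $J=J(\epsilon_s)$). (4) (Training.) $\widehat{\mathcal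 S}$ is $\epsilon_t$-trained for some $\epsilon_t>0$, i.e. $\Pi_j<\epsilon_t$ for all $1\le j\le J$. (5) (Boundedness and Lipschitz network.) There are finite constants $C_{\mathcal F},C_{\mathcal T},C_{\mathcal N}$ with $\|f\|_{L^\infty(\Omega)}\le C_{\mathcal F}$, $\|\theta\|_{L^\infty(\Omega)}\le C_{\mathcal T}$, $\|\eta\|_{L^\infty(\Gamma_\eta)}\le C_{\mathcal N}$ for all $f\in\mathcal F,\theta\in\mathcal T,\eta\in\mathcal N$; there are finite positive constants with $\|A\|_2\le C_A$, $\|\widetilde A\|_2\le C_{\widetilde A}$, $\|\boldsymbol\tau\|_{L^2(\Omega)}\le C_\tau$; the branch $D$ satisfies $\|D(\widehat\Theta)-D(\widehat\Theta')\|_2\le L_D\|\widehat\Theta-\widehat\Theta'\|_2$ for all $\widehat\Theta,\widehat\Theta'\in\widehat{\mathcal T}$; and $\|D(\widehat\Theta_0)\|_2$ is bounded for some $\widehat\Theta_0\in\widehat{\mathcal T}$. (6) (Sensor quadrature.) The sensor nodes, with positive weights $\{\widehat w_i\}_{i=1}^k$, $\{\widehat w_i^b\}_{i=1}^{k'}$, satisfy for functions $g:\Omega\to\mathbb R$ and $g_b:\Gamma_\eta\to\mathbb R$ $$\Big|\sum_{i=1}^k\widehat w_i g^2(\widehat x_i)-\int_\Omega g^2\,dx\Big|\le\frac{\widehat C_Q(g)}{k^\alpha},\qquad \Big|\sum_{i=1}^{k'}\widehat w^b_i g_b^2(\widehat x^b_i)-\int_{\Gamma_\eta}g_b^2\,dx\Big|\le\frac{\widehat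 C_{b,Q}(g_b)}{(k')^{\alpha'}},$$ and the constants $\widehat C_{Q,\mathcal F}=\sup_{f,f'\in\mathcal F}\widehat C_Q(f-f')$, $\widehat C_{Q,\mathcal T}=\sup_{\theta,\theta'\in\mathcal T}\widehat C_Q(\theta-\theta')$, $\widehat C_{b,Q,\mathcal N}=\sup_{\eta,\eta'\in\mathcal N}\widehat C_{b,Q}(\eta-\eta')$ are finite. Then for every $(f,\theta,\eta)\in\mathcal X$ the generalization error satisfies $$\|\mathcal S(f,\theta,\eta)-\widehat{\mathcal S}(\widehat{\mathcal P}(f,\theta,\eta))\|_{L^2(\Omega)}\le C_{h,\mathbb S}\,\epsilon_h+\overline C_S\,\epsilon_s+\sqrt{\epsilon_t}+\overline C_Q\Big(\frac1{k^{\alpha/2}}+\frac1{(k')^{\alpha'/2}}+\frac1{L^{\gamma/2}}\Big),$$ where $\overline C_S,\overline C_Q$ depend on the stability constants $C_{\rm stab}$ and $\widehat C_{\rm stab}$ (the latter being the stability constant of the network), the sensor quadrature weights $\widehat w_i,\widehat w_i^b$, and the constants $\widehat C_{Q,\mathcal F},\widehat C_{Q,\mathcal T},\widehat C_{b,Q,\mathcal N}$.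
   Context: PDE setting. $\Omega\subset\mathbb R^d$ is an open bounded domain with piecewise smooth boundary $\Gamma=\Gamma_g\cup\Gamma_\eta$; $H^1_g=\{u\in H^1(\Omega):u|_{\Gamma_g}=0\}$. The data space is $\mathcal X=\mathcal F\times\mathcal T\times\mathcal N$ with $\mathcal F\subset L^2(\Omega)\cap C(\Omega)$, $\mathcal T\subset L^\infty(\Omega)\cap C(\overline\Omega)$, $\mathcal N\subset L^2(\Gamma_\eta)\cap C(\Gamma_\eta)$. For each $\theta$, $a(\cdot,\cdot;\theta)$ is the bilinear form of a second-order elliptic operator, and the weak problem: find $u\in H^1_g$ with $a(w,u;\theta)=(w,f)_{L^2(\Omega)}+(w,\eta)_{L^2(\Gamma_\eta)}$ for all $w\in H^1_g$, is assumed well-posed. The solution operator is $\mathcal S:\mathcal X\to\mathcal V\subset H^1_g$, $\mathcal S(f,\theta,\eta)=u$, with $\mathcal V\subset C(\overline\Omega)$. Numerical solver. $\mathcal V^h$ is the space with continuous basis functions $\phi_1,\dots,\phi_q$, $\Phi=(\phi_1,\dots,\phi_q)^\top$. The projector $\mathcal P(f,\theta,\eta)=(f^h,\theta^h,\eta^h)$ takes $f,\theta$ to their $L^2(\Omega)$-projections onto $\mathcal V^h$ and $\eta$ to its $L^2(\Gamma_\eta)$-projection onto $\mathcal V^h|_{\Gamma_\eta}$; write $f^h=F^\top\Phi$, $\eta^h=H^\top\Phi|_{\Gamma_\eta}$ (with $H_i=0$ when $\phi_i$ vanishes a.e. on $\Gamma_\eta$). With $K_{ij}(\theta^h)=a(\phi_i,\phi_j;\theta^h)$,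 $M_{ij}=(\phi_i,\phi_j)_{L^2(\Omega)}$, $\widetilde M_{ij}=(\phi_i,\phi_j)_{L^2(\Gamma_\eta)}$, and $K(\theta^h)$ assumed invertible for all $\theta^h$ in the image of $\mathcal T$, the discrete solution operator is $\mathcal S^h(f^h,\theta^h,\eta^h)=\big(K^{-1}(\theta^h)(MF+\widetilde MH)\big)^\top\Phi$. Network. With interior sensor nodes $\widehat x_1,\dots,\widehat x_k\in\Omega$ and boundary sensor nodes $\widehat x^b_1,\dots,\widehat x^b_{k'}\in\Gamma_\eta$, the sensing operator is $\widehat{\mathcal P}(f,\theta,\eta)=(\widehat F,\widehat\Theta,\widehat N)$, $\widehat F=(f(\widehat x_i))_{i=1}^k$, $\widehat\Theta=(\theta(\widehat x_i))_{i=1}^k$, $\widehat N=(\eta(\widehat x_i^b))_{i=1}^{k'}$; $\widehat{\mathcal T}=\{(\theta(\widehat x_i))_{i=1}^k:\theta\in\mathcal T\}\subset\mathbb R^k$. The (trained) VarMiON (variationally mimetic operator network) is $$\widehat{\mathcal S}(\widehat F,\widehat\Theta,\widehat N)=\big(D(\widehat\Theta)A\widehat F+D(\widehat\Theta)\widetilde A\widehat N\big)^\top\boldsymbol\tau,$$ with a non-linear branch $D$ with values in $\mathbb R^{p\times p}$, matrices $A\in\mathbb R^{p\times k}$, $\widetilde A\in\mathbb R^{p\times k'}$, and trunk functions $\boldsymbol\tau=(\tau_1,\dots,\tau_p)^\top$, $\tau_i:\mathbb R^d\to\mathbb R$. $\|\cdot\|_2$ is the Euclidean norm of vectors and the spectral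 norm of matrices; $\|\boldsymbol\tau\|_{L^2(\Omega)}=(\sum_i\|\tau_i\|_{L^2(\Omega)}^2)^{1/2}$. Training. Output nodes $x_1,\dots,x_L\in\Omega$ with weights $w_1,\dots,w_L$ satisfy, for functions $g:\Omega\to\mathbb R$, $|\sum_{l=1}^Lw_lg^2(x_l)-\int_\Omega g^2\,dx|\le C_Q(g)/L^\gamma$. For training samples $(f_j,\theta_j,\eta_j)$, $e_j=\mathcal S^h(\mathcal P(f_j,\theta_j,\eta_j))-\widehat{\mathcal S}(\widehat{\mathcal P}(f_j,\theta_j,\eta_j))$ and the per-sample loss of the trained network is $\Pi_j=\sum_{l=1}^Lw_l\,e_j(x_l)^2$. Network stability constant. Under hypothesis (5), $\widehat C_{\rm stab}$ is the constant in the estimate $\|\widehat{\mathcal S}(\widehat{\mathcal P}(f,\theta,\eta))-\widehat{\mathcal S}(\widehat{\mathcal P}(f',\theta',\eta'))\|_{L^2(\Omega)}\le\widehat C_{\rm stab}(\|\widehat F-\widehat F'\|_2+\|\widehat\Theta-\widehat\Theta'\|_2+\|\widehat N-\widehat N'\|_2)$ for all pairs of data in $\mathcal X$; it depends on the bounds $C_{\mathcal F},C_{\mathcal T},C_{\mathcal N},C_A,C_{\widetilde A},C_\tau$, the numbers of sensor nodes $k,k'$, and $L_D$.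
   Formalization: The constant C̄_Q may also depend on max_j C_Q(e_j), the output quadrature constants of the training errors, and Ĉ_stab also on the bound for ‖D(Θ̂_0)‖_2; without these dependences the claim is false. *)

theory Defs
  imports "HOL-Analysis.Analysis" "HOL-Probability.Essential_Supremum"
begin

section \<open>Lebesgue spaces\<close>

text \<open>Elements of function spaces over a set are represented by total functions; only their values
  on the set matter.  The pointwise values matter as well (point sensors, quadrature nodes), so we do
  not pass to classes modulo equality almost everywhere.\<close>

definition L2 :: "'b measure \<Rightarrow> ('b \<Rightarrow> real) set" where
  "L2 M = {f \<in> borel_measurable M. integrable M (\<lambda>x. (f x)\<^sup>2)}"

definition L2_inner :: "'b measure \<Rightarrow> ('b \<Rightarrow> real) \<Rightarrow> ('b \<Rightarrow> real) \<Rightarrow> real" where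
  "L2_inner M f g = (LINT x|M. f x * g x)"

definition L2_norm :: "'b measure \<Rightarrow> ('b \<Rightarrow> real) \<Rightarrow> real" where
  "L2_norm M f = sqrt (LINT x|M. (f x)\<^sup>2)"

definition L2_dist :: "'b measure \<Rightarrow> ('b \<Rightarrow> real) \<Rightarrow> ('b \<Rightarrow> real) \<Rightarrow> real" where
  "L2_dist M f g = L2_norm M (\<lambda>x. f x - g x)"

definition Linf_norm :: "'b measure \<Rightarrow> ('b \<Rightarrow> real) \<Rightarrow> ereal" where
  "Linf_norm M f = esssup M (\<lambda>x. ereal \<bar>f x\<bar>)"

definition Linf :: "'b measure \<Rightarrow> ('b \<Rightarrow> real) set" where
  "Linf M = {f \<in> borel_measurable M. Linf_norm M f < \<infinity>}"

section \<open>Smooth functions, hypersurfaces and surface measure\<close>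

definition dir_deriv :: "'a::euclidean_space \<Rightarrow> ('a \<Rightarrow> real) \<Rightarrow> 'a \<Rightarrow> real" where
  "dir_deriv b f x = frechet_derivative f (at x) b"

text \<open>Infinite differentiability, for open \<open>U\<close>: all iterated partial derivatives exist and are again
  (totally) differentiable.\<close>

definition smooth_on :: "'a::euclidean_space set \<Rightarrow> ('a \<Rightarrow> real) \<Rightarrow> bool" where
  "smooth_on U f \<longleftrightarrow>
     (\<forall>bs. set bs \<subseteq> Basis \<longrightarrow> (\<forall>x\<in>U. foldr dir_deriv bs f differentiable (at x)))"

definition hausdorff_content :: "nat \<Rightarrow> 'a::metric_space set \<Rightarrow> ennreal" where
  "hausdorff_content s B =
     (if B = {} then 0 else ennreal (unit_ball_vol (real s) * (diameter B / 2) ^ s))"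

definition hausdorff_pre :: "nat \<Rightarrow> real \<Rightarrow> 'a::metric_space set \<Rightarrow> ennreal" where
  "hausdorff_pre s \<delta> A =
     (INF C \<in> {C :: nat \<Rightarrow> 'a set. A \<subseteq> (\<Union>n. C n) \<and> (\<forall>n. bounded (C n) \<and> diameter (C n) \<le> \<delta>)}.
        \<Sum>n. hausdorff_content s (C n))"

definition hausdorff_outer :: "nat \<Rightarrow> 'a::metric_space set \<Rightarrow> ennreal" where
  "hausdorff_outer s A = (SUP \<delta>\<in>{0<..}. hausdorff_pre s \<delta> A)"

definition hausdorff_measure :: "nat \<Rightarrow> 'a::metric_space measure" where
  "hausdorff_measure s = measure_of UNIV (sets borel) (hausdorff_outer s)"

text \<open>\<^const>\<open>measure_of\<close> yields the zero measure for set functions that are not countably additive; this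
  does not happen here, see \<open>emeasure_hausdorff_measure\<close> below.\<close>

lemma hausdorff_pre_mono: "A \<subseteq> B \<Longrightarrow> hausdorff_pre s \<delta> A \<le> hausdorff_pre s \<delta> B"
  unfolding hausdorff_pre_def by (rule INF_superset_mono) auto

lemma hausdorff_pre_antimono: "\<delta> \<le> \<delta>' \<Longrightarrow> hausdorff_pre s \<delta>' A \<le> hausdorff_pre s \<delta> A"
  unfolding hausdorff_pre_def by (rule INF_superset_mono) (auto intro: order_trans)

lemma hausdorff_pre_UN:
  fixes A :: "nat \<Rightarrow> 'a::metric_space set"
  shows "hausdorff_pre s \<delta> (\<Union>n. A n) \<le> (\<Sum>n. hausdorff_pre s \<delta> (A n))"
proof (rule ennreal_le_epsilon)
  fix e :: real assume e: "0 < e" and fin: "(\<Sum>n. hausdorff_pre s \<delta> (A n)) < top"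
  have *: "\<exists>C :: nat \<Rightarrow> 'a set. A n \<subseteq> (\<Union>m. C m) \<and> (\<forall>m. bounded (C m) \<and> diameter (C m) \<le> \<delta>) \<and>
       (\<Sum>m. hausdorff_content s (C m)) \<le> hausdorff_pre s \<delta> (A n) + e * (1/2) ^ Suc n" for n
  proof -
    have "hausdorff_pre s \<delta> (A n) < hausdorff_pre s \<delta> (A n) + e * (1/2) ^ Suc n"
      using fin e by (auto simp add: less_top dest!: ennreal_suminf_lessD)
    then show ?thesis
      unfolding hausdorff_pre_def[of s \<delta> "A n"] INF_less_iff by (auto intro: less_imp_le)
  qed
  then obtain B :: "nat \<Rightarrow> nat \<Rightarrow> 'a set" where B: "\<And>n. A n \<subseteq> (\<Union>m. B n m)"
    "\<And>n m. bounded (B n m)" "\<And>n m. diameter (B n m) \<le> \<delta>"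
    and Ble: "\<And>n. (\<Sum>m. hausdorff_content s (B n m)) \<le> hausdorff_pre s \<delta> (A n) + e * (1/2) ^ Suc n"
    by metis
  define C where "C = case_prod B \<circ> prod_decode"
  have AC: "(\<Union>n. A n) \<subseteq> (\<Union>k. C k)"
    using B(1) by (auto simp add: C_def subset_eq) (metis prod.case prod_encode_inverse)
  have "hausdorff_pre s \<delta> (\<Union>n. A n) \<le> (\<Sum>k. hausdorff_content s (C k))"
    unfolding hausdorff_pre_def
    by (rule INF_lower) (use AC B(2,3) in \<open>auto simp: C_def split_def\<close>)
  also have "\<dots> = (\<Sum>n. \<Sum>m. hausdorff_content s (B n m))"
    unfolding C_def comp_def by (intro suminf_ennreal_2dimen) auto
  also have "\<dots> \<le> (\<Sum>n. hausdorff_pre s \<delta> (A n) + e * (1/2) ^ Suc n)"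
    by (intro suminf_le allI Ble) auto
  also have "\<dots> = (\<Sum>n. hausdorff_pre s \<delta> (A n)) + (\<Sum>n. ennreal e * ennreal ((1/2) ^ Suc n))"
    using e by (subst suminf_add[symmetric])
               (auto simp del: ennreal_suminf_cmult simp add: ennreal_mult[symmetric])
  also have "\<dots> = (\<Sum>n. hausdorff_pre s \<delta> (A n)) + e"
    unfolding ennreal_suminf_cmult
    by (subst suminf_ennreal_eq[OF zero_le_power power_half_series]) auto
  finally show "hausdorff_pre s \<delta> (\<Union>n. A n) \<le> (\<Sum>n. hausdorff_pre s \<delta> (A n)) + ennreal e" .
qed

lemma hausdorff_outer_empty: "hausdorff_outer s ({} :: 'a::metric_space set) = 0"
proof -
  have "hausdorff_pre s \<delta> ({} :: 'a set) = 0" if "0 < \<delta>" for \<delta>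
    unfolding hausdorff_pre_def
    by (rule antisym, rule INF_lower2[of "\<lambda>_. {}"]) (use that in \<open>auto simp: hausdorff_content_def\<close>)
  then have "(SUP \<delta>\<in>{0<..}. hausdorff_pre s \<delta> ({} :: 'a set)) \<le> 0"
    by (intro SUP_least) auto
  then show ?thesis by (simp add: hausdorff_outer_def)
qed

lemma hausdorff_outer_mono: "A \<subseteq> B \<Longrightarrow> hausdorff_outer s A \<le> hausdorff_outer s B"
  unfolding hausdorff_outer_def by (intro SUP_mono) (auto intro: hausdorff_pre_mono)

lemma hausdorff_outer_UN: "hausdorff_outer s (\<Union>n. A n) \<le> (\<Sum>n. hausdorff_outer s (A (n::nat)))"
proof -
  have "hausdorff_pre s \<delta> (\<Union>n. A n) \<le> (\<Sum>n. hausdorff_outer s (A n))" if "0 < \<delta>" for \<delta>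
    by (rule order_trans[OF hausdorff_pre_UN], rule suminf_le)
       (use that in \<open>auto simp: hausdorff_outer_def intro: SUP_upper\<close>)
  then show ?thesis by (auto simp: hausdorff_outer_def[of s "\<Union>n. A n"] intro: SUP_least)
qed

lemma hausdorff_outer_Un: "hausdorff_outer s (A \<union> B) \<le> hausdorff_outer s A + hausdorff_outer s B"
proof -
  let ?A = "\<lambda>n::nat. if n = 0 then A else if n = 1 then B else {}"
  have "A \<union> B = (\<Union>n. ?A n)" by (auto split: if_splits)
  then have "hausdorff_outer s (A \<union> B) \<le> (\<Sum>n. hausdorff_outer s (?A n))"
    using hausdorff_outer_UN[of s ?A] by simp
  also have "\<dots> = (\<Sum>n\<in>{0,1}. hausdorff_outer s (?A n))"
    by (rule suminf_finite) (auto simp: hausdorff_outer_empty)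
  finally show ?thesis by simp
qed

lemma hausdorff_pre_separated:
  fixes A B :: "'a::metric_space set"
  assumes sep: "\<And>x y. x \<in> A \<Longrightarrow> y \<in> B \<Longrightarrow> \<delta> < dist x y"
  shows "hausdorff_pre s \<delta> A + hausdorff_pre s \<delta> B \<le> hausdorff_pre s \<delta> (A \<union> B)"
  unfolding hausdorff_pre_def[of s \<delta> "A \<union> B"]
proof (rule INF_greatest, clarify)
  fix C :: "nat \<Rightarrow> 'a set"
  assume C: "A \<union> B \<subseteq> (\<Union>n. C n)" "\<forall>n. bounded (C n) \<and> diameter (C n) \<le> \<delta>"
  have \<delta>: "0 \<le> \<delta>" using C(2) diameter_ge_0 order_trans by blast
  define CA where "CA n = (if C n \<inter> A = {} then {} else C n)" for n
  define CB where "CB n = (if C n \<inter> B = {} then {} else C n)" for n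
  have "hausdorff_pre s \<delta> A \<le> (\<Sum>n. hausdorff_content s (CA n))"
    unfolding hausdorff_pre_def
    by (rule INF_lower) (use C \<delta> in \<open>auto simp: CA_def subset_eq\<close>, blast)
  moreover have "hausdorff_pre s \<delta> B \<le> (\<Sum>n. hausdorff_content s (CB n))"
    unfolding hausdorff_pre_def
    by (rule INF_lower) (use C \<delta> in \<open>auto simp: CB_def subset_eq\<close>, blast)
  ultimately have "hausdorff_pre s \<delta> A + hausdorff_pre s \<delta> B
      \<le> (\<Sum>n. hausdorff_content s (CA n)) + (\<Sum>n. hausdorff_content s (CB n))"
    by (rule add_mono)
  also have "\<dots> = (\<Sum>n. hausdorff_content s (CA n) + hausdorff_content s (CB n))"
    by (rule suminf_add) auto
  also have "\<dots> \<le> (\<Sum>n. hausdorff_content s (C n))"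
  proof (rule suminf_le)
    fix n
    have "C n \<inter> A = {} \<or> C n \<inter> B = {}"
    proof (rule ccontr)
      assume "\<not> ?thesis"
      then obtain x y where xy: "x \<in> C n" "x \<in> A" "y \<in> C n" "y \<in> B" by auto
      then have "dist x y \<le> diameter (C n)"
        using C(2) by (intro diameter_bounded_bound) auto
      then show False using sep[OF xy(2,4)] C(2) by (meson leD order_trans)
    qed
    then show "hausdorff_content s (CA n) + hausdorff_content s (CB n) \<le> hausdorff_content s (C n)"
      by (auto simp: CA_def CB_def hausdorff_content_def)
  qed auto
  finally show "hausdorff_pre s \<delta> A + hausdorff_pre s \<delta> B \<le> (\<Sum>n. hausdorff_content s (C n))" .
qed

lemma hausdorff_outer_separated:
  fixes A B :: "'a::metric_space set"
  assumes r: "0 < r" and sep: "\<And>x y. x \<in> A \<Longrightarrow> y \<in> B \<Longrightarrow> r \<le> dist x y"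
  shows "hausdorff_outer s A + hausdorff_outer s B \<le> hausdorff_outer s (A \<union> B)"
proof -
  have "hausdorff_outer s A + hausdorff_outer s B =
      (SUP \<delta>\<in>{0<..}. hausdorff_pre s \<delta> A + hausdorff_pre s \<delta> B)"
    unfolding hausdorff_outer_def
  proof (rule SUP_add_directed_ennreal[symmetric])
    fix i j :: real assume "i \<in> {0<..}" "j \<in> {0<..}"
    then show "\<exists>k\<in>{0<..}. hausdorff_pre s i A + hausdorff_pre s j B
        \<le> hausdorff_pre s k A + hausdorff_pre s k B"
      by (intro bexI[of _ "min i j"] add_mono hausdorff_pre_antimono) auto
  qed
  also have "\<dots> \<le> hausdorff_outer s (A \<union> B)"
  proof (rule SUP_least)
    fix \<delta> :: real assume \<delta>: "\<delta> \<in> {0<..}"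
    let ?d = "min \<delta> (r / 2)"
    have "hausdorff_pre s \<delta> A + hausdorff_pre s \<delta> B \<le> hausdorff_pre s ?d A + hausdorff_pre s ?d B"
      by (intro add_mono hausdorff_pre_antimono) auto
    also have "\<dots> \<le> hausdorff_pre s ?d (A \<union> B)"
    proof (rule hausdorff_pre_separated)
      fix x y assume "x \<in> A" "y \<in> B"
      then show "?d < dist x y" using sep[of x y] r by linarith
    qed
    also have "\<dots> \<le> hausdorff_outer s (A \<union> B)"
      unfolding hausdorff_outer_def by (rule SUP_upper) (use \<delta> r in auto)
    finally show "hausdorff_pre s \<delta> A + hausdorff_pre s \<delta> B \<le> hausdorff_outer s (A \<union> B)" .
  qed
  finally show ?thesis .
qed

text \<open>Caratheodory's criterion for closed sets.\<close>

lemma hausdorff_outer_closed_split: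
  fixes F A :: "'a::metric_space set"
  assumes F: "closed F"
  shows "hausdorff_outer s (A \<inter> F) + hausdorff_outer s (A - F) \<le> hausdorff_outer s A"
proof (cases "F = {} \<or> hausdorff_outer s A = \<infinity>")
  case True
  then show ?thesis by (auto simp: hausdorff_outer_empty)
next
  case False
  let ?\<mu> = "hausdorff_outer s"
  have Fne: "F \<noteq> {}" and fin: "?\<mu> A < \<infinity>" using False by (auto simp: less_top)
  define E where "E n = {x\<in>A. 1 / real (Suc n) \<le> infdist x F}" for n
  define R where "R n = {x\<in>A. 1 / real (Suc (Suc n)) \<le> infdist x F \<and> infdist x F < 1 / real (Suc n)}" for n
  have inf: "infdist x F \<le> infdist y F + dist x y" for x y
    by (rule infdist_triangle)
  have E1: "?\<mu> (A \<inter> F) + ?\<mu> (E n) \<le> ?\<mu> A" for n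
  proof -
    have "?\<mu> (A \<inter> F) + ?\<mu> (E n) \<le> ?\<mu> ((A \<inter> F) \<union> E n)"
    proof (rule hausdorff_outer_separated[of "1 / real (Suc n)"])
      fix x y assume "x \<in> A \<inter> F" "y \<in> E n"
      then show "1 / real (Suc n) \<le> dist x y"
        using inf[of y x] by (auto simp: E_def dist_commute)
    qed auto
    also have "\<dots> \<le> ?\<mu> A" by (rule hausdorff_outer_mono) (auto simp: E_def)
    finally show ?thesis .
  qed
  have cover: "A - F \<subseteq> E n \<union> (\<Union>m. R (m + n))" for n
  proof
    fix x assume x: "x \<in> A - F"
    then have pos: "0 < infdist x F"
      using F Fne by (metis Diff_iff in_closed_iff_infdist_zero infdist_nonneg less_eq_real_def)
    show "x \<in> E n \<union> (\<Union>m. R (m + n))"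
    proof (cases "x \<in> E n")
      case nE: False
      obtain k where k: "1 / real (Suc k) < infdist x F"
        using pos nat_approx_posE by blast
      define m where "m = (LEAST k. 1 / real (Suc k) \<le> infdist x F)"
      have m: "1 / real (Suc m) \<le> infdist x F"
        unfolding m_def by (rule LeastI[of _ k]) (use k in simp)
      have lt: "infdist x F < 1 / real (Suc i)" if "i < m" for i
        using not_less_Least[of i "\<lambda>k. 1 / real (Suc k) \<le> infdist x F"] that
        unfolding m_def by simp
      have xA: "x \<in> A" using x by simp
      have nlt: "infdist x F < 1 / real (Suc n)" using nE xA by (auto simp: E_def)
      have "n < m"
      proof (rule ccontr)
        assume "\<not> n < m"
        then have "1 / real (Suc n) \<le> 1 / real (Suc m)" by (intro divide_left_mono) auto
        then show False using nlt m by linarith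
      qed
      then obtain i where i: "m = Suc (i + n)" by (metis add.commute less_imp_Suc_add)
      have "x \<in> R (i + n)" using m lt[of "i + n"] xA i by (auto simp: R_def)
      then show ?thesis by auto
    qed auto
  qed
  have sum_le: "(\<Sum>i<N. ?\<mu> (R (2 * i + c))) \<le> ?\<mu> (\<Union>i<N. R (2 * i + c))" for N c
  proof (induction N)
    case (Suc N)
    show ?case
    proof (cases N)
      case 0
      have "{..<Suc 0} = {0::nat}" by auto
      then show ?thesis using 0 by simp
    next
      case (Suc M)
      let ?r = "1 / real (Suc (Suc (2 * M + c))) - 1 / real (Suc (Suc (Suc (2 * M + c))))"
      have rpos: "0 < ?r" unfolding diff_gt_0_iff_gt by (rule divide_strict_left_mono) auto
      have "(\<Sum>i<Suc N. ?\<mu> (R (2 * i + c))) \<le> ?\<mu> (\<Union>i<N. R (2 * i + c)) + ?\<mu> (R (2 * N + c))"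
        using Suc.IH by (simp add: add_right_mono)
      also have "\<dots> \<le> ?\<mu> ((\<Union>i<N. R (2 * i + c)) \<union> R (2 * N + c))"
      proof (rule hausdorff_outer_separated[OF rpos])
        fix x y assume "x \<in> (\<Union>i<N. R (2 * i + c))" and y: "y \<in> R (2 * N + c)"
        then obtain i where i: "i < N" "x \<in> R (2 * i + c)" by auto
        have xR: "1 / real (Suc (Suc (2 * i + c))) \<le> infdist x F" using i by (auto simp: R_def)
        have "1 / real (Suc (Suc (2 * M + c))) \<le> 1 / real (Suc (Suc (2 * i + c)))"
          using i(1) Suc by (intro divide_left_mono) auto
        moreover have "infdist y F < 1 / real (Suc (2 * N + c))" using y by (auto simp: R_def)
        moreover have "Suc (2 * N + c) = Suc (Suc (Suc (2 * M + c)))" using Suc by simp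
        ultimately show "?r \<le> dist x y" using xR inf[of x y] by simp
      qed
      also have "(\<Union>i<N. R (2 * i + c)) \<union> R (2 * N + c) = (\<Union>i<Suc N. R (2 * i + c))"
        by (auto simp: less_Suc_eq)
      finally show ?thesis .
    qed
  qed simp
  have half: "(\<Sum>i. ?\<mu> (R (2 * i + c))) \<le> ?\<mu> A" for c
  proof (rule suminf_le_const[OF summableI])
    fix N
    have "?\<mu> (\<Union>i<N. R (2 * i + c)) \<le> ?\<mu> A" by (rule hausdorff_outer_mono) (auto simp: R_def)
    then show "(\<Sum>i<N. ?\<mu> (R (2 * i + c))) \<le> ?\<mu> A" by (rule order_trans[OF sum_le])
  qed
  have full: "(\<Sum>m. ?\<mu> (R m)) \<le> ?\<mu> A + ?\<mu> A"
  proof (rule suminf_le_const[OF summableI])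
    fix N
    have "(\<Sum>m<N. ?\<mu> (R m)) \<le> (\<Sum>m<2 * N. ?\<mu> (R m))"
      by (rule sum_mono2) auto
    also have "\<dots> = (\<Sum>i<N. ?\<mu> (R (2 * i + 0))) + (\<Sum>i<N. ?\<mu> (R (2 * i + 1)))"
      by (induction N) (auto simp: algebra_simps)
    also have "\<dots> \<le> ?\<mu> A + ?\<mu> A"
      by (intro add_mono order_trans[OF sum_le_suminf[OF summableI] half]) auto
    finally show "(\<Sum>m<N. ?\<mu> (R m)) \<le> ?\<mu> A + ?\<mu> A" .
  qed
  have fullfin: "(\<Sum>m. ?\<mu> (R m)) \<noteq> \<infinity>"
    using full fin by (auto simp: top_unique)
  have lim: "(\<lambda>n. \<Sum>m. ?\<mu> (R (m + n))) \<longlonglongrightarrow> 0"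
  proof -
    have fR: "?\<mu> (R m) \<noteq> \<infinity>" for m
      using hausdorff_outer_mono[of "R m" A s] fin by (auto simp: R_def top_unique)
    define g where "g m = enn2real (?\<mu> (R m))" for m
    have g: "?\<mu> (R m) = ennreal (g m)" for m using fR[of m] by (simp add: g_def less_top)
    have gnn: "0 \<le> g m" for m by (simp add: g_def)
    have sg: "summable g"
      using fullfin gnn by (intro summable_suminf_not_top) (auto simp: g)
    have "(\<lambda>n. \<Sum>m. g (m + n)) \<longlonglongrightarrow> 0"
    proof -
      have "(\<lambda>n. (\<Sum>m. g m) - (\<Sum>m<n. g m)) \<longlonglongrightarrow> (\<Sum>m. g m) - (\<Sum>m. g m)"
        by (intro tendsto_intros summable_LIMSEQ sg)
      then show ?thesis using suminf_minus_initial_segment[OF sg] by simp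
    qed
    then have "(\<lambda>n. ennreal (\<Sum>m. g (m + n))) \<longlonglongrightarrow> ennreal 0" by (rule tendsto_ennrealI)
    moreover have "(\<Sum>m. ?\<mu> (R (m + n))) = ennreal (\<Sum>m. g (m + n))" for n
      unfolding g using gnn sg by (intro suminf_ennreal2) (auto simp: summable_iff_shift)
    ultimately show ?thesis by simp
  qed
  have le: "?\<mu> (A \<inter> F) + ?\<mu> (A - F) \<le> ?\<mu> A + (\<Sum>m. ?\<mu> (R (m + n)))" for n
  proof -
    have "?\<mu> (A - F) \<le> ?\<mu> (E n) + ?\<mu> (\<Union>m. R (m + n))"
      using hausdorff_outer_mono[OF cover] hausdorff_outer_Un order_trans by blast
    also have "\<dots> \<le> ?\<mu> (E n) + (\<Sum>m. ?\<mu> (R (m + n)))"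
      by (intro add_left_mono hausdorff_outer_UN)
    finally have "?\<mu> (A \<inter> F) + ?\<mu> (A - F) \<le> (?\<mu> (A \<inter> F) + ?\<mu> (E n)) + (\<Sum>m. ?\<mu> (R (m + n)))"
      by (simp add: add.assoc add_left_mono)
    also have "\<dots> \<le> ?\<mu> A + (\<Sum>m. ?\<mu> (R (m + n)))" by (intro add_right_mono E1)
    finally show ?thesis .
  qed
  have "(\<lambda>n. ?\<mu> A + (\<Sum>m. ?\<mu> (R (m + n)))) \<longlonglongrightarrow> ?\<mu> A + 0"
    by (intro tendsto_add tendsto_const lim)
  then show ?thesis using le by (intro LIMSEQ_le_const[of _ "?\<mu> A"]) auto
qed

lemma emeasure_hausdorff_measure:
  fixes B :: "'a::metric_space set"
  assumes "B \<in> sets borel"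
  shows "emeasure (hausdorff_measure s) B = hausdorff_outer s B"
proof -
  let ?\<mu> = "hausdorff_outer s :: 'a set \<Rightarrow> ennreal"
  let ?L = "lambda_system UNIV (Pow UNIV) ?\<mu>"
  interpret P: sigma_algebra "UNIV :: 'a set" "Pow UNIV" by (rule sigma_algebra_Pow)
  have "outer_measure_space (Pow UNIV) ?\<mu>"
    unfolding outer_measure_space_def
    by (auto simp: positive_def increasing_def countably_subadditive_def hausdorff_outer_empty
        intro: hausdorff_outer_mono hausdorff_outer_UN)
  then have ms: "measure_space UNIV ?L ?\<mu>" by (rule P.caratheodory_lemma)
  then interpret L: sigma_algebra UNIV ?L by (simp add: measure_space_def)
  have "{F. closed F} \<subseteq> ?L"
  proof
    fix F :: "'a set" assume "F \<in> {F. closed F}"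
    then have "closed F" by simp
    then have "?\<mu> (x \<inter> F) + ?\<mu> (x - F) = ?\<mu> x" for x
      using hausdorff_outer_closed_split[of F s x] hausdorff_outer_Un[of s "x \<inter> F" "x - F"]
      by (simp add: Int_Diff_Un antisym)
    then show "F \<in> ?L" unfolding P.lambda_system_eq by auto
  qed
  then have "sigma_sets UNIV {F. closed F} \<subseteq> ?L" by (rule L.sigma_sets_subset)
  then have sub: "sets borel \<subseteq> ?L" by (simp add: borel_eq_closed)
  have "countably_additive (sets borel) ?\<mu>"
    using ms sub unfolding measure_space_def countably_additive_def by (meson subset_trans subset_eq)
  moreover have "positive (sets borel) ?\<mu>" by (simp add: positive_def hausdorff_outer_empty)
  ultimately show ?thesis
    unfolding hausdorff_measure_def
    by (intro emeasure_measure_of_sigma)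
       (use assms sets.sigma_algebra_axioms[of "borel :: 'a measure"] in auto)
qed

definition surface_on :: "'a::euclidean_space set \<Rightarrow> 'a measure" where
  "surface_on S = restrict_space (hausdorff_measure (DIM('a) - 1)) S"

definition smooth_hypersurface :: "'a::euclidean_space set \<Rightarrow> bool" where
  "smooth_hypersurface S \<longleftrightarrow>
     (\<forall>x\<in>S. \<exists>U \<psi>. open U \<and> x \<in> U \<and> smooth_on U \<psi> \<and>
        (\<forall>y\<in>U. \<exists>b\<in>Basis. dir_deriv b \<psi> y \<noteq> 0) \<and> S \<inter> U = {y\<in>U. \<psi> y = 0})"

text \<open>A finite union of smooth pieces.  Every piece \<open>P\<close> is a smooth hypersurface \<open>S\<close> of finite area,
  together with any part of its edge \<open>closure S - S\<close>, which has zero area.\<close>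

definition piecewise_smooth :: "'a::euclidean_space set \<Rightarrow> bool" where
  "piecewise_smooth \<Gamma> \<longleftrightarrow>
     (\<exists>\<P>. finite \<P> \<and> \<Gamma> = \<Union>\<P> \<and>
        (\<forall>P\<in>\<P>. P \<in> sets borel \<and>
           (\<exists>S. smooth_hypersurface S \<and> S \<subseteq> P \<and> P \<subseteq> closure S \<and>
                hausdorff_outer (DIM('a) - 1) S < \<infinity> \<and>
                hausdorff_outer (DIM('a) - 1) (closure S - S) = 0)))"

section \<open>The weak boundary value problem\<close>

definition test_function :: "'a::euclidean_space set \<Rightarrow> ('a \<Rightarrow> real) \<Rightarrow> bool" where
  "test_function \<Omega> \<phi> \<longleftrightarrow>
     smooth_on UNIV \<phi> \<and> compact (closure {x. \<phi> x \<noteq> 0}) \<and> closure {x. \<phi> x \<noteq> 0} \<subseteq> \<Omega>"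

definition is_weak_grad :: "'a::euclidean_space set \<Rightarrow> ('a \<Rightarrow> real) \<Rightarrow> ('a \<Rightarrow> 'a) \<Rightarrow> bool" where
  "is_weak_grad \<Omega> u G \<longleftrightarrow>
     (\<forall>b\<in>Basis. (\<lambda>x. G x \<bullet> b) \<in> L2 (lebesgue_on \<Omega>) \<and>
        (\<forall>\<phi>. test_function \<Omega> \<phi> \<longrightarrow>
           (LINT x|lebesgue_on \<Omega>. u x * dir_deriv b \<phi> x) =
           - (LINT x|lebesgue_on \<Omega>. (G x \<bullet> b) * \<phi> x)))"

definition H1 :: "'a::euclidean_space set \<Rightarrow> ('a \<Rightarrow> real) set" where
  "H1 \<Omega> = {u \<in> L2 (lebesgue_on \<Omega>). \<exists>G. is_weak_grad \<Omega> u G}"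

text \<open>Determined almost everywhere on \<open>\<Omega>\<close> for \<open>u \<in> H1 \<Omega>\<close>.\<close>

definition weak_grad :: "'a::euclidean_space set \<Rightarrow> ('a \<Rightarrow> real) \<Rightarrow> 'a \<Rightarrow> 'a" where
  "weak_grad \<Omega> u = (SOME G. is_weak_grad \<Omega> u G)"

definition H1_norm :: "'a::euclidean_space set \<Rightarrow> ('a \<Rightarrow> real) \<Rightarrow> real" where
  "H1_norm \<Omega> u = sqrt (LINT x|lebesgue_on \<Omega>. (u x)\<^sup>2 + (norm (weak_grad \<Omega> u x))\<^sup>2)"

text \<open>\<open>g\<close> is the trace of \<open>u\<close> on the boundary portion \<open>S\<close>: the \<open>L\<^sup>2(S)\<close>-limit of the boundary
  values of functions, continuous up to the boundary, that approximate \<open>u\<close> in \<open>H1 \<Omega>\<close>.\<close>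

definition has_trace ::
    "'a::euclidean_space set \<Rightarrow> 'a set \<Rightarrow> ('a \<Rightarrow> real) \<Rightarrow> ('a \<Rightarrow> real) \<Rightarrow> bool" where
  "has_trace \<Omega> S u g \<longleftrightarrow> g \<in> L2 (surface_on S) \<and>
     (\<exists>v :: nat \<Rightarrow> 'a \<Rightarrow> real.
        (\<forall>n. v n \<in> H1 \<Omega> \<and> continuous_on (closure \<Omega>) (v n) \<and> v n \<in> L2 (surface_on S)) \<and>
        (\<lambda>n. H1_norm \<Omega> (\<lambda>x. u x - v n x)) \<longlonglongrightarrow> 0 \<and>
        (\<lambda>n. L2_dist (surface_on S) g (v n)) \<longlonglongrightarrow> 0)"

definition H1_zero_on :: "'a::euclidean_space set \<Rightarrow> 'a set \<Rightarrow> ('a \<Rightarrow> real) set" where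
  "H1_zero_on \<Omega> \<Gamma>\<^sub>g = {u \<in> H1 \<Omega>. has_trace \<Omega> \<Gamma>\<^sub>g u (\<lambda>_. 0)}"

text \<open>Coefficients of a second-order operator in divergence form,
  \<open>u \<mapsto> - div (A \<nabla>u + b u) + c \<bullet> \<nabla>u + d u\<close>.\<close>

type_synonym 'a coeffs = "('a \<Rightarrow> 'a \<Rightarrow>\<^sub>L 'a) \<times> ('a \<Rightarrow> 'a) \<times> ('a \<Rightarrow> 'a) \<times> ('a \<Rightarrow> real)"

definition elliptic :: "'a::euclidean_space set \<Rightarrow> 'a coeffs \<Rightarrow> bool" where
  "elliptic \<Omega> = (\<lambda>(A, b, c, d).
     A \<in> borel_measurable (lebesgue_on \<Omega>) \<and> b \<in> borel_measurable (lebesgue_on \<Omega>) \<and>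
     c \<in> borel_measurable (lebesgue_on \<Omega>) \<and> d \<in> borel_measurable (lebesgue_on \<Omega>) \<and>
     (\<exists>B. AE x in lebesgue_on \<Omega>.
        norm (A x) \<le> B \<and> norm (b x) \<le> B \<and> norm (c x) \<le> B \<and> \<bar>d x\<bar> \<le> B) \<and>
     (\<exists>\<mu>>0. AE x in lebesgue_on \<Omega>. \<forall>\<xi>. \<mu> * (norm \<xi>)\<^sup>2 \<le> \<xi> \<bullet> blinfun_apply (A x) \<xi>))"

definition bilinear_form ::
    "'a::euclidean_space set \<Rightarrow> 'a coeffs \<Rightarrow> ('a \<Rightarrow> real) \<Rightarrow> ('a \<Rightarrow> real) \<Rightarrow> real" where
  "bilinear_form \<Omega> = (\<lambda>(A, b, c, d) w u.
     LINT x|lebesgue_on \<Omega>.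
       weak_grad \<Omega> w x \<bullet> (blinfun_apply (A x) (weak_grad \<Omega> u x) + u x *\<^sub>R b x)
       + w x * (c x \<bullet> weak_grad \<Omega> u x + d x * u x))"

definition weak_solution ::
    "'a::euclidean_space set \<Rightarrow> 'a set \<Rightarrow> 'a set \<Rightarrow> 'a coeffs \<Rightarrow> ('a \<Rightarrow> real) \<Rightarrow> ('a \<Rightarrow> real)
     \<Rightarrow> ('a \<Rightarrow> real) \<Rightarrow> bool" where
  "weak_solution \<Omega> \<Gamma>\<^sub>g \<Gamma>\<^sub>\<eta> \<kappa> f \<eta> u \<longleftrightarrow> u \<in> H1_zero_on \<Omega> \<Gamma>\<^sub>g \<and>
     (\<forall>w\<in>H1_zero_on \<Omega> \<Gamma>\<^sub>g. \<forall>w\<^sub>\<Gamma>. has_trace \<Omega> \<Gamma>\<^sub>\<eta> w w\<^sub>\<Gamma> \<longrightarrow>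
        bilinear_form \<Omega> \<kappa> w u = L2_inner (lebesgue_on \<Omega>) w f + L2_inner (surface_on \<Gamma>\<^sub>\<eta>) w\<^sub>\<Gamma> \<eta>)"

definition domain_with_boundary :: "'a::euclidean_space set \<Rightarrow> 'a set \<Rightarrow> 'a set \<Rightarrow> bool" where
  "domain_with_boundary \<Omega> \<Gamma>\<^sub>g \<Gamma>\<^sub>\<eta> \<longleftrightarrow>
     open \<Omega> \<and> bounded \<Omega> \<and> connected \<Omega> \<and> \<Omega> \<noteq> {} \<and>
     frontier \<Omega> = \<Gamma>\<^sub>g \<union> \<Gamma>\<^sub>\<eta> \<and> piecewise_smooth \<Gamma>\<^sub>g \<and> piecewise_smooth \<Gamma>\<^sub>\<eta>"

type_synonym 'a datum = "('a \<Rightarrow> real) \<times> ('a \<Rightarrow> real) \<times> ('a \<Rightarrow> real)"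

definition data_spaces ::
    "'a::euclidean_space set \<Rightarrow> 'a set \<Rightarrow> ('a \<Rightarrow> real) set \<Rightarrow> ('a \<Rightarrow> real) set \<Rightarrow> ('a \<Rightarrow> real) set \<Rightarrow> bool"
  where
  "data_spaces \<Omega> \<Gamma>\<^sub>\<eta> \<F> \<T> \<N> \<longleftrightarrow>
     \<F> \<subseteq> L2 (lebesgue_on \<Omega>) \<inter> {f. continuous_on \<Omega> f} \<and>
     \<T> \<subseteq> Linf (lebesgue_on \<Omega>) \<inter> {\<theta>. continuous_on (closure \<Omega>) \<theta>} \<and>
     \<N> \<subseteq> L2 (surface_on \<Gamma>\<^sub>\<eta>) \<inter> {\<eta>. continuous_on \<Gamma>\<^sub>\<eta> \<eta>}"

definition well_posed ::
    "'a::euclidean_space set \<Rightarrow> 'a set \<Rightarrow> 'a set \<Rightarrow> (('a \<Rightarrow> real) \<Rightarrow> 'a coeffs) \<Rightarrow> 'a datum set \<Rightarrow> bool"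
  where
  "well_posed \<Omega> \<Gamma>\<^sub>g \<Gamma>\<^sub>\<eta> \<kappa> \<X> \<longleftrightarrow>
     (\<forall>(f, \<theta>, \<eta>)\<in>\<X>.
        (\<exists>u. weak_solution \<Omega> \<Gamma>\<^sub>g \<Gamma>\<^sub>\<eta> (\<kappa> \<theta>) f \<eta> u) \<and>
        (\<forall>u u'. weak_solution \<Omega> \<Gamma>\<^sub>g \<Gamma>\<^sub>\<eta> (\<kappa> \<theta>) f \<eta> u \<longrightarrow> weak_solution \<Omega> \<Gamma>\<^sub>g \<Gamma>\<^sub>\<eta> (\<kappa> \<theta>) f \<eta> u' \<longrightarrow>
           (AE x in lebesgue_on \<Omega>. u x = u' x)))"

definition solution_operator ::
    "'a::euclidean_space set \<Rightarrow> 'a set \<Rightarrow> 'a set \<Rightarrow> (('a \<Rightarrow> real) \<Rightarrow> 'a coeffs) \<Rightarrow> 'a datum set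
     \<Rightarrow> ('a datum \<Rightarrow> 'a \<Rightarrow> real) \<Rightarrow> bool" where
  "solution_operator \<Omega> \<Gamma>\<^sub>g \<Gamma>\<^sub>\<eta> \<kappa> \<X> \<S> \<longleftrightarrow>
     (\<forall>(f, \<theta>, \<eta>)\<in>\<X>.
        weak_solution \<Omega> \<Gamma>\<^sub>g \<Gamma>\<^sub>\<eta> (\<kappa> \<theta>) f \<eta> (\<S> (f, \<theta>, \<eta>)) \<and>
        continuous_on (closure \<Omega>) (\<S> (f, \<theta>, \<eta>)))"

text \<open>The topology of the product of \<open>L\<^sup>2(\<Omega>)\<close>, \<open>L\<^sup>2(\<Omega>)\<close> and \<open>L\<^sup>2(\<Gamma>\<^sub>\<eta>)\<close>.\<close>

definition data_topology :: "'a::euclidean_space set \<Rightarrow> 'a set \<Rightarrow> 'a datum topology" where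
  "data_topology \<Omega> \<Gamma>\<^sub>\<eta> =
     (let \<Y> = L2 (lebesgue_on \<Omega>) \<times> L2 (lebesgue_on \<Omega>) \<times> L2 (surface_on \<Gamma>\<^sub>\<eta>) in
      topology_generated_by
        {{(f', \<theta>', \<eta>') \<in> \<Y>. L2_dist (lebesgue_on \<Omega>) f f' + L2_dist (lebesgue_on \<Omega>) \<theta> \<theta>'
             + L2_dist (surface_on \<Gamma>\<^sub>\<eta>) \<eta> \<eta>' < r} | f \<theta> \<eta> r. (f, \<theta>, \<eta>) \<in> \<Y> \<and> 0 < r})"

section \<open>The numerical solver\<close>

definition fe_fun :: "('q::finite \<Rightarrow> 'a \<Rightarrow> real) \<Rightarrow> real^'q \<Rightarrow> 'a \<Rightarrow> real" where
  "fe_fun \<phi> c x = c \<bullet> (\<chi> i. \<phi> i x)"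

text \<open>The basis functions must lie in \<open>H1 \<Omega>\<close> for the stiffness matrix to make sense.\<close>

definition fe_basis :: "'a::euclidean_space set \<Rightarrow> ('q::finite \<Rightarrow> 'a \<Rightarrow> real) \<Rightarrow> bool" where
  "fe_basis \<Omega> \<phi> \<longleftrightarrow> (\<forall>i. continuous_on (closure \<Omega>) (\<phi> i) \<and> \<phi> i \<in> H1 \<Omega>) \<and>
     (\<forall>c. (\<forall>x\<in>\<Omega>. fe_fun \<phi> c x = 0) \<longrightarrow> c = 0)"

text \<open>On the boundary the basis may become linearly dependent; the projection is then determined
  almost everywhere.\<close>

definition L2_proj :: "'a measure \<Rightarrow> ('q::finite \<Rightarrow> 'a \<Rightarrow> real) \<Rightarrow> ('a \<Rightarrow> real) \<Rightarrow> 'a \<Rightarrow> real" where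
  "L2_proj M \<phi> g = (SOME v. v \<in> range (fe_fun \<phi>) \<and>
     (\<forall>w\<in>range (fe_fun \<phi>). L2_inner M (\<lambda>x. g x - v x) w = 0))"

definition data_proj ::
    "'a::euclidean_space set \<Rightarrow> 'a set \<Rightarrow> ('q::finite \<Rightarrow> 'a \<Rightarrow> real) \<Rightarrow> 'a datum \<Rightarrow> 'a datum" where
  "data_proj \<Omega> \<Gamma>\<^sub>\<eta> \<phi> = (\<lambda>(f, \<theta>, \<eta>).
     (L2_proj (lebesgue_on \<Omega>) \<phi> f, L2_proj (lebesgue_on \<Omega>) \<phi> \<theta>, L2_proj (surface_on \<Gamma>\<^sub>\<eta>) \<phi> \<eta>))"

definition coeff_int :: "'a set \<Rightarrow> ('q::finite \<Rightarrow> 'a \<Rightarrow> real) \<Rightarrow> ('a \<Rightarrow> real) \<Rightarrow> real^'q" where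
  "coeff_int \<Omega> \<phi> f\<^sub>h = (THE c. \<forall>x\<in>\<Omega>. f\<^sub>h x = fe_fun \<phi> c x)"

definition coeff_bd ::
    "'a::euclidean_space set \<Rightarrow> ('q::finite \<Rightarrow> 'a \<Rightarrow> real) \<Rightarrow> ('a \<Rightarrow> real) \<Rightarrow> real^'q" where
  "coeff_bd \<Gamma>\<^sub>\<eta> \<phi> \<eta>\<^sub>h = (SOME c. (AE x in surface_on \<Gamma>\<^sub>\<eta>. \<eta>\<^sub>h x = fe_fun \<phi> c x) \<and>
     (\<forall>i. (AE x in surface_on \<Gamma>\<^sub>\<eta>. \<phi> i x = 0) \<longrightarrow> c $ i = 0))"

definition mass_matrix :: "'a measure \<Rightarrow> ('q::finite \<Rightarrow> 'a \<Rightarrow> real) \<Rightarrow> real^'q^'q" where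
  "mass_matrix M \<phi> = (\<chi> i j. L2_inner M (\<phi> i) (\<phi> j))"

definition stiffness_matrix ::
    "'a::euclidean_space set \<Rightarrow> 'a coeffs \<Rightarrow> ('q::finite \<Rightarrow> 'a \<Rightarrow> real) \<Rightarrow> real^'q^'q" where
  "stiffness_matrix \<Omega> \<kappa> \<phi> = (\<chi> i j. bilinear_form \<Omega> \<kappa> (\<phi> i) (\<phi> j))"

definition discrete_solution ::
    "'a::euclidean_space set \<Rightarrow> 'a set \<Rightarrow> (('a \<Rightarrow> real) \<Rightarrow> 'a coeffs) \<Rightarrow> ('q::finite \<Rightarrow> 'a \<Rightarrow> real)
     \<Rightarrow> 'a datum \<Rightarrow> 'a \<Rightarrow> real" where
  "discrete_solution \<Omega> \<Gamma>\<^sub>\<eta> \<kappa> \<phi> = (\<lambda>(f\<^sub>h, \<theta>\<^sub>h, \<eta>\<^sub>h).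
     fe_fun \<phi> (matrix_inv (stiffness_matrix \<Omega> (\<kappa> \<theta>\<^sub>h) \<phi>) *v
       (mass_matrix (lebesgue_on \<Omega>) \<phi> *v coeff_int \<Omega> \<phi> f\<^sub>h +
        mass_matrix (surface_on \<Gamma>\<^sub>\<eta>) \<phi> *v coeff_bd \<Gamma>\<^sub>\<eta> \<phi> \<eta>\<^sub>h)))"

section \<open>The network\<close>

definition sense :: "('k::finite \<Rightarrow> 'a) \<Rightarrow> ('a \<Rightarrow> real) \<Rightarrow> real^'k" where
  "sense X g = (\<chi> i. g (X i))"

definition sensing ::
    "('k::finite \<Rightarrow> 'a) \<Rightarrow> ('kb::finite \<Rightarrow> 'a) \<Rightarrow> 'a datum \<Rightarrow> (real^'k) \<times> (real^'k) \<times> (real^'kb)" where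
  "sensing X Xb = (\<lambda>(f, \<theta>, \<eta>). (sense X f, sense X \<theta>, sense Xb \<eta>))"

definition varmion ::
    "(real^'k \<Rightarrow> real^'p^'p) \<Rightarrow> real^'k^'p \<Rightarrow> real^'kb^'p \<Rightarrow> ('p::finite \<Rightarrow> 'a \<Rightarrow> real)
     \<Rightarrow> (real^'k) \<times> (real^'k) \<times> (real^'kb) \<Rightarrow> 'a \<Rightarrow> real" where
  "varmion D A A' \<tau> = (\<lambda>(F, \<Theta>, N) x.
     ((D \<Theta> ** A) *v F + (D \<Theta> ** A') *v N) \<bullet> (\<chi> i. \<tau> i x))"

definition spectral_norm :: "real^'m::finite^'n::finite \<Rightarrow> real" where
  "spectral_norm B = onorm ((*v) B)"

definition network_stable ::
    "'a::euclidean_space set \<Rightarrow> ('k::finite \<Rightarrow> 'a) \<Rightarrow> ('kb::finite \<Rightarrow> 'a)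
     \<Rightarrow> ((real^'k) \<times> (real^'k) \<times> (real^'kb) \<Rightarrow> 'a \<Rightarrow> real) \<Rightarrow> 'a datum set \<Rightarrow> real \<Rightarrow> bool" where
  "network_stable \<Omega> X Xb NN \<X> C \<longleftrightarrow>
     (\<forall>(f, \<theta>, \<eta>)\<in>\<X>. \<forall>(f', \<theta>', \<eta>')\<in>\<X>.
        L2_dist (lebesgue_on \<Omega>) (NN (sensing X Xb (f, \<theta>, \<eta>))) (NN (sensing X Xb (f', \<theta>', \<eta>')))
        \<le> C * (norm (sense X f - sense X f') + norm (sense X \<theta> - sense X \<theta>')
               + norm (sense Xb \<eta> - sense Xb \<eta>')))"

end

theory Submission
  imports Defs
begin

text \<open>For a datum \<open>d\<close> with nearby sample \<open>d\<^sub>j\<close>, the error splits along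
  \<open>\<S> d\<close>, \<open>\<S> d\<^sub>j\<close>, \<open>\<S>\<^sub>h (\<P> d\<^sub>j)\<close>, \<open>NN d\<^sub>j\<close>, \<open>NN d\<close>: stability of the solution operator, numerical error,
  training loss with the output quadrature, and stability of the network.  In the last term the
  sensor quadrature turns \<open>L\<^sup>2\<close>-closeness of the data into closeness of the sensor values, at the cost
  of the smallest quadrature weight.  Stability of the network needs the essential bounds on the data
  at the individual sensors; for continuous data these follow because nonempty relatively open
  subsets of \<open>\<Omega>\<close> and of the piecewise smooth \<open>\<Gamma>\<^sub>\<eta>\<close> have positive measure.\<close>

section \<open>Square-integrable functions\<close>

lemma L2_norm_nonneg [simp]: "0 \<le> L2_norm M f"
  by (simp add: L2_norm_def)

lemma L2_norm_power2: "(L2_norm M f)\<^sup>2 = (LINT x|M. (f x)\<^sup>2)"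
  by (simp add: L2_norm_def)

lemma L2_dist_nonneg [simp]: "0 \<le> L2_dist M f g"
  by (simp add: L2_dist_def)

lemma L2_dist_commute: "L2_dist M f g = L2_dist M g f"
  by (simp add: L2_dist_def L2_norm_def power2_commute)

text \<open>Young's inequality with a free weight. The case \<open>t = 1\<close> makes
  \<open>L2\<close> closed under addition; an optimized \<open>t\<close> gives the triangle
  inequality for the norm.\<close>

lemma weighted_square_le:
  fixes a b t :: real
  assumes "0 < t"
  shows "(a + b)\<^sup>2 \<le> (1 + t) * a\<^sup>2 + (1 + 1 / t) * b\<^sup>2"
proof -
  have "0 \<le> (t * a - b)\<^sup>2 / t" using assms by simp
  also have "\<dots> = t * a\<^sup>2 - 2 * a * b + b\<^sup>2 / t"
    using assms by (simp add: field_simps power2_eq_square)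
  finally show ?thesis by (simp add: algebra_simps power2_sum)
qed

lemma L2_add:
  assumes "f \<in> L2 M" "g \<in> L2 M"
  shows "(\<lambda>x. f x + g x) \<in> L2 M"
proof -
  have m: "f \<in> borel_measurable M" "g \<in> borel_measurable M"
    and i: "integrable M (\<lambda>x. (f x)\<^sup>2)" "integrable M (\<lambda>x. (g x)\<^sup>2)"
    using assms by (auto simp: L2_def)
  have "integrable M (\<lambda>x. (f x + g x)\<^sup>2)"
  proof (rule Bochner_Integration.integrable_bound)
    show "integrable M (\<lambda>x. 2 * (f x)\<^sup>2 + 2 * (g x)\<^sup>2)" using i by simp
    show "AE x in M. norm ((f x + g x)\<^sup>2) \<le> norm (2 * (f x)\<^sup>2 + 2 * (g x)\<^sup>2)"
    proof (rule AE_I2)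
      fix x show "norm ((f x + g x)\<^sup>2) \<le> norm (2 * (f x)\<^sup>2 + 2 * (g x)\<^sup>2)"
        using weighted_square_le[of 1 "f x" "g x"] by simp
    qed
  qed (use m in measurable)
  then show ?thesis using m by (simp add: L2_def)
qed

lemma L2_cmult: "f \<in> L2 M \<Longrightarrow> (\<lambda>x. c * f x) \<in> L2 M"
  by (auto simp: L2_def power_mult_distrib)

lemma L2_diff:
  assumes "f \<in> L2 M" "g \<in> L2 M"
  shows "(\<lambda>x. f x - g x) \<in> L2 M"
  using L2_add[OF assms(1) L2_cmult[OF assms(2), of "-1"]] by simp

lemma L2_sum:
  assumes "\<And>i. i \<in> I \<Longrightarrow> f i \<in> L2 M"
  shows "(\<lambda>x. \<Sum>i\<in>I. f i x) \<in> L2 M"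
  using assms
proof (induction I rule: infinite_finite_induct)
  case (insert i I)
  then show ?case by (simp add: L2_add)
qed (simp_all add: L2_def)

lemma L2_inner_vec:
  fixes c :: "real^'n"
  assumes "\<And>i. g i \<in> L2 M"
  shows "(\<lambda>x. c \<bullet> (\<chi> i. g i x)) \<in> L2 M"
  using assms by (simp add: inner_vec_def L2_sum L2_cmult)

text \<open>Integrating the weighted inequality with \<open>t = b / a\<close> gives exactly
  \<open>(a + b)\<^sup>2\<close>, because \<open>(1 + b / a) * a\<^sup>2\<close> and
  \<open>(1 + a / b) * b\<^sup>2\<close> each contribute one product \<open>a * b\<close>.\<close>

lemma L2_norm_add_le:
  assumes "f \<in> L2 M" "g \<in> L2 M"
  shows "L2_norm M (\<lambda>x. f x + g x) \<le> L2_norm M f + L2_norm M g"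
proof (rule field_le_epsilon)
  fix e :: real assume e: "0 < e"
  \<comment> \<open>Both norms are enlarged by \<open>e / 2\<close>, so that the ratio
    \<open>b / a\<close> is defined and positive even when a norm vanishes.\<close>
  define a b where "a = L2_norm M f + e / 2" and "b = L2_norm M g + e / 2"
  have a: "0 < a" "L2_norm M f \<le> a" and b: "0 < b" "L2_norm M g \<le> b"
    using e by (auto simp: a_def b_def intro: add_nonneg_pos)
  have i: "integrable M (\<lambda>x. (f x)\<^sup>2)" "integrable M (\<lambda>x. (g x)\<^sup>2)"
    using assms by (auto simp: L2_def)
  have "(L2_norm M (\<lambda>x. f x + g x))\<^sup>2
      \<le> (LINT x|M. (1 + b / a) * (f x)\<^sup>2 + (1 + 1 / (b / a)) * (g x)\<^sup>2)"
    unfolding L2_norm_power2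
  proof (rule integral_mono)
    show "integrable M (\<lambda>x. (f x + g x)\<^sup>2)" using L2_add[OF assms] by (simp add: L2_def)
    show "(f x + g x)\<^sup>2 \<le> (1 + b / a) * (f x)\<^sup>2 + (1 + 1 / (b / a)) * (g x)\<^sup>2" for x
      by (rule weighted_square_le) (use a b in simp)
  qed (use i in simp)
  also have "\<dots> = (1 + b / a) * (L2_norm M f)\<^sup>2 + (1 + 1 / (b / a)) * (L2_norm M g)\<^sup>2"
    using i by (simp add: L2_norm_power2)
  also have "\<dots> \<le> (1 + b / a) * a\<^sup>2 + (1 + 1 / (b / a)) * b\<^sup>2"
    using a b by (intro add_mono mult_left_mono power_mono) auto
  also have "\<dots> = (a + b)\<^sup>2" using a b by (simp add: field_simps power2_eq_square)
  finally have "L2_norm M (\<lambda>x. f x + g x) \<le> a + b"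
    by (rule power2_le_imp_le) (use a b in simp)
  then show "L2_norm M (\<lambda>x. f x + g x) \<le> L2_norm M f + L2_norm M g + e"
    by (simp add: a_def b_def)
qed

lemma L2_dist_triangle:
  assumes "f \<in> L2 M" "g \<in> L2 M" "h \<in> L2 M"
  shows "L2_dist M f h \<le> L2_dist M f g + L2_dist M g h"
  using L2_norm_add_le[OF L2_diff[OF assms(1,2)] L2_diff[OF assms(2,3)]]
  by (simp add: L2_dist_def)

text \<open>Cauchy-Schwarz at each point, then integration. This reduces distances between network
  outputs to distances between coefficient vectors, the trunk functions entering only through their
  joint norm.\<close>

lemma L2_norm_inner_vec_le:
  fixes c :: "real^'n"
  assumes "\<And>i. g i \<in> L2 M"
  shows "L2_norm M (\<lambda>x. c \<bullet> (\<chi> i. g i x)) \<le> norm c * L2_set (\<lambda>i. L2_norm M (g i)) UNIV"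
proof (rule power2_le_imp_le)
  have i: "integrable M (\<lambda>x. (g i x)\<^sup>2)" for i using assms by (auto simp: L2_def)
  have "(L2_norm M (\<lambda>x. c \<bullet> (\<chi> i. g i x)))\<^sup>2 \<le> (LINT x|M. (norm c)\<^sup>2 * (\<Sum>i\<in>UNIV. (g i x)\<^sup>2))"
    unfolding L2_norm_power2
  proof (rule integral_mono)
    show "integrable M (\<lambda>x. (c \<bullet> (\<chi> i. g i x))\<^sup>2)"
      using L2_inner_vec[of g M c, OF assms] by (simp add: L2_def)
    show "(c \<bullet> (\<chi> i. g i x))\<^sup>2 \<le> (norm c)\<^sup>2 * (\<Sum>i\<in>UNIV. (g i x)\<^sup>2)" for x
    proof -
      have "(\<chi> i. g i x) \<bullet> (\<chi> i. g i x) = (\<Sum>i\<in>UNIV. (g i x)\<^sup>2)"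
        by (simp add: inner_vec_def power2_eq_square)
      then show ?thesis
        using Cauchy_Schwarz_ineq[of c "\<chi> i. g i x"] by (simp add: power2_norm_eq_inner)
    qed
  qed (use i in simp)
  also have "\<dots> = (norm c * L2_set (\<lambda>i. L2_norm M (g i)) UNIV)\<^sup>2"
    using i by (simp add: power_mult_distrib L2_set_def sum_nonneg L2_norm_power2)
  finally show "(L2_norm M (\<lambda>x. c \<bullet> (\<chi> i. g i x)))\<^sup>2 \<le> (norm c * L2_set (\<lambda>i. L2_norm M (g i)) UNIV)\<^sup>2" .
qed simp

lemma Linf_norm_AE:
  assumes "Linf_norm M f \<le> ereal C"
  shows "AE x in M. \<bar>f x\<bar> \<le> C"
proof -
  have "AE x in M. ereal \<bar>f x\<bar> \<le> Linf_norm M f"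
    unfolding Linf_norm_def by (rule esssup_AE)
  then show ?thesis
    using assms by (auto elim!: eventually_mono dest: order_trans)
qed

text \<open>The coefficients in \<open>\<T>\<close> are only assumed essentially bounded; on a
  domain of finite measure this makes their differences admissible in the sensor quadrature.\<close>

lemma Linf_subset_L2:
  assumes "finite_measure M"
  shows "Linf M \<subseteq> L2 M"
proof
  fix f assume "f \<in> Linf M"
  then have m: "f \<in> borel_measurable M" and "Linf_norm M f < \<infinity>" by (auto simp: Linf_def)
  then obtain C where "Linf_norm M f \<le> ereal C"
    using less_PInf_Ex_of_nat[of "Linf_norm M f"] by (auto intro: less_imp_le)
  then have "AE x in M. norm ((f x)\<^sup>2) \<le> C\<^sup>2"
    by (rule Linf_norm_AE[THEN eventually_mono])
       (use abs_le_square_iff in fastforce)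
  then have "integrable M (\<lambda>x. (f x)\<^sup>2)"
    by (intro finite_measure.integrable_const_bound[OF assms]) (use m in auto)
  then show "f \<in> L2 M" using m by (simp add: L2_def)
qed

section \<open>From bounds almost everywhere to bounds at the sensor nodes\<close>

lemma open_superlevel:
  fixes g :: "'a::topological_space \<Rightarrow> real"
  assumes "open U" "continuous_on U g"
  shows "open {x\<in>U. c < g x}"
proof -
  have "{x\<in>U. c < g x} = U \<inter> g -` {c<..}" by auto
  then show ?thesis using continuous_open_preimage[OF assms(2,1) open_greaterThan] by simp
qed

text \<open>A violation at one point spreads, by continuity, to a nonempty open superlevel set,
  which cannot be Lebesgue null.\<close>

lemma continuous_le_if_AE_le_open:
  fixes g :: "'a::euclidean_space \<Rightarrow> real"
  assumes "open U" "continuous_on U g" "AE x in lebesgue_on U. g x \<le> C" "x \<in> U"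
  shows "g x \<le> C"
proof (rule ccontr)
  assume "\<not> g x \<le> C"
  define V where "V = {y\<in>U. C < g y}"
  have V: "open V" "x \<in> V"
    using assms open_superlevel[OF assms(1,2), of C] \<open>\<not> g x \<le> C\<close> by (auto simp: V_def)
  have "AE y in lebesgue. y \<in> U \<longrightarrow> g y \<le> C"
    using assms(1,3) by (simp add: AE_restrict_space_iff)
  then have "AE y in lebesgue. y \<notin> V" by (rule eventually_mono) (auto simp: V_def)
  then have "negligible V"
    using V(1) by (simp add: negligible_iff_null_sets AE_iff_null_sets)
  then show False using open_not_negligible V by auto
qed

text \<open>A set of diameter \<open>d \<le> 1\<close>, thickened by length 1 in direction
  \<open>b\<close>, fits into a box with side \<open>2 * (d + 1) \<le> 4\<close> along
  \<open>b\<close> and sides \<open>2 * d\<close> otherwise. Its volume is thus a fixed multiple of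
  the content in one dimension less, the link between surface measure and volume.\<close>

lemma cover_thickened:
  fixes C :: "'a::euclidean_space set"
  assumes b: "b \<in> Basis" and C: "bounded C" "diameter C \<le> 1"
  shows "\<exists>B\<in>sets borel. {z + t *\<^sub>R b | z t. z \<in> C \<and> \<bar>t\<bar> \<le> 1} \<subseteq> B \<and>
     emeasure lborel B
       \<le> ennreal (4 ^ DIM('a) / unit_ball_vol (real (DIM('a) - 1))) * hausdorff_content (DIM('a) - 1) C"
proof (cases "C = {}")
  case True
  then show ?thesis by (intro bexI[of _ "{}"]) auto
next
  case False
  then obtain z0 where z0: "z0 \<in> C" by auto
  let ?s = "DIM('a) - 1"
  define d where "d = diameter C"
  \<comment> \<open>Half side lengths of the box centred at \<open>z0\<close>; the extra 1 along
    \<open>b\<close> absorbs the thickening.\<close>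
  define v :: 'a where "v = (\<Sum>i\<in>Basis. (if i = b then d + 1 else d) *\<^sub>R i)"
  have d: "0 \<le> d" "d \<le> 1" using C diameter_ge_0 by (auto simp: d_def)
  have v: "v \<bullet> i = (if i = b then d + 1 else d)" if "i \<in> Basis" for i
    using that by (simp add: v_def inner_sum_left_Basis)
  have "z + t *\<^sub>R b \<in> cbox (z0 - v) (z0 + v)" if "z \<in> C" "\<bar>t\<bar> \<le> 1" for z t
  proof -
    have "\<bar>(z - z0) \<bullet> i\<bar> \<le> d" if "i \<in> Basis" for i
      using diameter_bounded_bound[OF C(1) \<open>z \<in> C\<close> z0] Basis_le_norm[OF that, of "z - z0"]
      by (simp add: d_def dist_norm)
    moreover have "(t *\<^sub>R b) \<bullet> i = (if i = b then t else 0)" if "i \<in> Basis" for i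
      using b that by (auto simp: inner_Basis)
    ultimately have "\<bar>(z + t *\<^sub>R b - z0) \<bullet> i\<bar> \<le> v \<bullet> i" if "i \<in> Basis" for i
      using that \<open>\<bar>t\<bar> \<le> 1\<close> abs_triangle_ineq[of "(z - z0) \<bullet> i" "(t *\<^sub>R b) \<bullet> i"]
      by (fastforce simp: v inner_add_left inner_diff_left algebra_simps)
    then show ?thesis
      by (simp add: mem_box inner_add_left inner_diff_left abs_le_iff algebra_simps)
  qed
  moreover have "emeasure lborel (cbox (z0 - v) (z0 + v))
      \<le> ennreal (4 ^ DIM('a) / unit_ball_vol (real ?s)) * hausdorff_content ?s C"
  proof -
    define u where "u = unit_ball_vol (real ?s)"
    have u: "0 < u" by (simp add: u_def)
    have D: "DIM('a) = Suc ?s" using DIM_positive[where 'a='a] by simp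
    have "emeasure lborel (cbox (z0 - v) (z0 + v)) = ennreal (\<Prod>i\<in>Basis. 2 * (v \<bullet> i))"
      using d by (subst emeasure_lborel_cbox) (auto simp: v algebra_simps intro!: prod.cong)
    also have "(\<Prod>i\<in>Basis. 2 * (v \<bullet> i)) = 2 * (d + 1) * (\<Prod>i\<in>Basis - {b}. 2 * d)"
      using b by (subst prod.remove[of _ b]) (auto simp: v intro!: prod.cong)
    also have "\<dots> = 2 * (d + 1) * (2 * d) ^ ?s" using b by (simp add: card_Diff_singleton)
    also have "\<dots> \<le> 4 * (2 * d) ^ ?s" using d by (intro mult_right_mono) auto
    also have "\<dots> = 4 ^ DIM('a) / u * (u * (d / 2) ^ ?s)"
    proof -
      have "4 ^ DIM('a) * (d / 2) ^ ?s = 4 * (4 * (d / 2)) ^ ?s"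
        by (subst D) (simp only: power_Suc power_mult_distrib mult.assoc)
      then show ?thesis using u by simp
    qed
    finally show ?thesis
      using False d u
      by (simp add: hausdorff_content_def d_def u_def ennreal_leI flip: ennreal_mult)
  qed
  ultimately show ?thesis by (intro bexI[of _ "cbox (z0 - v) (z0 + v)"]) auto
qed

text \<open>Covers of \<open>Z\<close> with small total content become, set by set, covers of the
  thickening with small total volume.\<close>

lemma negligible_thickened:
  fixes Z :: "'a::euclidean_space set"
  assumes b: "b \<in> Basis" and Z: "hausdorff_outer (DIM('a) - 1) Z = 0"
  shows "negligible {z + t *\<^sub>R b | z t. z \<in> Z \<and> \<bar>t\<bar> \<le> 1}"
  unfolding negligible_outer
proof (intro allI impI)
  fix e :: real assume e: "0 < e"
  let ?s = "DIM('a) - 1"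
  define K where "K = 4 ^ DIM('a) / unit_ball_vol (real ?s)"
  have K: "0 < K" by (simp add: K_def)
  \<comment> \<open>The outer measure is the supremum over all scales, so scale 1 is already null;
    it supplies the bound on diameters that \<open>cover_thickened\<close> requires.\<close>
  have "hausdorff_pre ?s 1 Z \<le> hausdorff_outer ?s Z"
    unfolding hausdorff_outer_def by (rule SUP_upper) simp
  then have "hausdorff_pre ?s 1 Z < ennreal (e / K)" using Z e K by simp
  then obtain C :: "nat \<Rightarrow> 'a set" where C: "Z \<subseteq> (\<Union>n. C n)" "\<And>n. bounded (C n)"
    "\<And>n. diameter (C n) \<le> 1" and lt: "(\<Sum>n. hausdorff_content ?s (C n)) < ennreal (e / K)"
    unfolding hausdorff_pre_def INF_less_iff by auto
  have "\<forall>n. \<exists>B. B \<in> sets borel \<and> {z + t *\<^sub>R b | z t. z \<in> C n \<and> \<bar>t\<bar> \<le> 1} \<subseteq> B \<and>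
      emeasure lborel B \<le> ennreal K * hausdorff_content ?s (C n)"
  proof
    fix n
    show "\<exists>B. B \<in> sets borel \<and> {z + t *\<^sub>R b | z t. z \<in> C n \<and> \<bar>t\<bar> \<le> 1} \<subseteq> B \<and>
      emeasure lborel B \<le> ennreal K * hausdorff_content ?s (C n)"
      using cover_thickened[OF b C(2)[of n] C(3)[of n]] by (simp only: K_def Bex_def)
  qed
  from choice[OF this] obtain B where B: "\<forall>n. B n \<in> sets borel \<and>
      {z + t *\<^sub>R b | z t. z \<in> C n \<and> \<bar>t\<bar> \<le> 1} \<subseteq> B n \<and>
      emeasure lborel (B n) \<le> ennreal K * hausdorff_content ?s (C n)" ..
  let ?T = "\<Union>n. B n"
  have "emeasure lborel ?T \<le> (\<Sum>n. emeasure lborel (B n))"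
    by (rule emeasure_subadditive_countably) (use B in auto)
  also have "\<dots> \<le> (\<Sum>n. ennreal K * hausdorff_content ?s (C n))"
    by (intro suminf_le) (use B in auto)
  also have "\<dots> = ennreal K * (\<Sum>n. hausdorff_content ?s (C n))" by simp
  also have "\<dots> < ennreal K * ennreal (e / K)"
    by (rule ennreal_mult_strict_left_mono) (use lt K in auto)
  also have "\<dots> = ennreal e" using K e by (simp flip: ennreal_mult)
  finally have T: "emeasure lborel ?T < ennreal e" .
  have "?T \<in> sets borel" using B by auto
  then have "?T \<in> sets lebesgue" "emeasure lebesgue ?T = emeasure lborel ?T" by auto
  then have "?T \<in> lmeasurable" and lt_e: "emeasure lebesgue ?T < ennreal e"
    using T by (auto simp: fmeasurable_def less_top intro: order.strict_trans)
  moreover from this have "measure lebesgue ?T < e"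
    using e by (simp add: emeasure_eq_measure2 ennreal_less_iff)
  moreover have "{z + t *\<^sub>R b | z t. z \<in> Z \<and> \<bar>t\<bar> \<le> 1} \<subseteq> ?T"
    using C(1) B by blast
  ultimately show "\<exists>T. {z + t *\<^sub>R b | z t. z \<in> Z \<and> \<bar>t\<bar> \<le> 1} \<subseteq> T \<and> T \<in> lmeasurable \<and> measure lebesgue T < e"
    by blast
qed

text \<open>If \<open>\<partial>\<^sub>b \<psi> \<noteq> 0\<close> at \<open>x\<close>, then on every segment in direction \<open>b\<close> near \<open>x\<close> the function \<open>\<psi>\<close> changes
  sign, so the thickening of \<open>{\<psi> = 0}\<close> in direction \<open>b\<close> contains a ball.  This replaces the
  parametrization of the hypersurface by the implicit function theorem.\<close>

lemma hausdorff_outer_hypersurface_pos: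
  fixes S :: "'a::euclidean_space set"
  assumes S: "smooth_hypersurface S" and V: "open V" and x: "x \<in> S" "x \<in> V"
  shows "hausdorff_outer (DIM('a) - 1) (S \<inter> V) \<noteq> 0"
proof
  assume null: "hausdorff_outer (DIM('a) - 1) (S \<inter> V) = 0"
  obtain U \<psi>0 where U: "open U" "x \<in> U" "smooth_on U \<psi>0" "S \<inter> U = {y\<in>U. \<psi>0 y = 0}"
    and "\<exists>b\<in>Basis. dir_deriv b \<psi>0 x \<noteq> 0"
    using bspec[OF S[unfolded smooth_hypersurface_def] x(1)]
    by (elim exE conjE) (rule that, auto)
  then obtain b where b: "b \<in> Basis" "dir_deriv b \<psi>0 x \<noteq> 0" by blast
  \<comment> \<open>normalize the sign so that \<open>\<psi>\<close> increases in direction \<open>b\<close>\<close>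
  define \<psi> where "\<psi> y = sgn (dir_deriv b \<psi>0 x) * \<psi>0 y" for y
  define c where "c = \<bar>dir_deriv b \<psi>0 x\<bar>"
  have diff0: "\<psi>0 differentiable (at y)" if "y \<in> U" for y
    using U(3) that unfolding smooth_on_def by (metis empty_iff empty_set foldr_Nil id_apply subsetI)
  have zero: "\<psi> y = 0 \<longleftrightarrow> \<psi>0 y = 0" for y using b by (simp add: \<psi>_def sgn_zero_iff)
  have x0: "\<psi> x = 0" using U x by (auto simp: zero)
  have cont: "continuous_on U \<psi>"
    unfolding \<psi>_def using diff0
    by (intro continuous_intros continuous_at_imp_continuous_on ballI differentiable_imp_continuous_within)
  \<comment> \<open>The chain rule along the line through \<open>x\<close> reduces the sign change
    to a statement about a function of one real variable.\<close>
  have "((\<lambda>t. \<psi>0 (x + t *\<^sub>R b)) has_real_derivative dir_deriv b \<psi>0 x) (at 0)"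
  proof -
    have F: "(\<psi>0 has_derivative frechet_derivative \<psi>0 (at x)) (at (x + 0 *\<^sub>R b))"
      using diff0[OF U(2)] by (simp add: frechet_derivative_works)
    have "((\<lambda>t. \<psi>0 (x + t *\<^sub>R b)) has_derivative (\<lambda>t. frechet_derivative \<psi>0 (at x) (t *\<^sub>R b))) (at 0)"
      by (rule has_derivative_compose[of "\<lambda>t. x + t *\<^sub>R b" "\<lambda>t. t *\<^sub>R b", OF _ F])
         (auto intro!: derivative_eq_intros)
    moreover have "(\<lambda>t. frechet_derivative \<psi>0 (at x) (t *\<^sub>R b)) = (*) (dir_deriv b \<psi>0 x)"
      using linear_frechet_derivative[OF diff0[OF U(2)]]
      by (auto simp: dir_deriv_def linear_scale)
    ultimately show ?thesis by (simp add: has_field_derivative_def)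
  qed
  then have der: "((\<lambda>t. \<psi> (x + t *\<^sub>R b)) has_real_derivative c) (at 0)"
    unfolding \<psi>_def c_def abs_sgn by (auto intro!: derivative_eq_intros simp: mult.commute)
  have c: "0 < c" using b by (simp add: c_def)
  obtain r where r: "0 < r" "ball x r \<subseteq> U \<inter> V"
    using U V x openE[of "U \<inter> V" x] by (metis IntI open_Int)
  obtain d1 where d1: "0 < d1" "\<And>h. 0 < h \<Longrightarrow> h < d1 \<Longrightarrow> 0 < \<psi> (x + h *\<^sub>R b)"
    using DERIV_pos_inc_right[OF der c] x0 by auto
  obtain d2 where d2: "0 < d2" "\<And>h. 0 < h \<Longrightarrow> h < d2 \<Longrightarrow> \<psi> (x + (- h) *\<^sub>R b) < 0"
    using DERIV_pos_inc_left[OF der c] x0 by auto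
  \<comment> \<open>\<open>h < d1\<close> and \<open>h < d2\<close> fix the signs at
    \<open>x + h b\<close> and \<open>x - h b\<close>; \<open>h \<le> r / 2\<close> keeps segments
    around points of the half ball inside \<open>U \<inter> V\<close>; \<open>h \<le> 1\<close>
    matches the length of the thickening.\<close>
  define h where "h = min (min d1 d2) (min r 1) / 2"
  have h: "0 < h" "h < d1" "h < d2" "h \<le> r / 2" "h \<le> 1"
    using d1(1) d2(1) r(1) by (auto simp: h_def)
  have nb: "norm b = 1" using b by simp
  have inball: "y + t *\<^sub>R b \<in> ball x r" if "y \<in> ball x (r / 2)" "\<bar>t\<bar> \<le> h" for y t
  proof -
    have "dist x (y + t *\<^sub>R b) \<le> dist x y + dist y (y + t *\<^sub>R b)" by (rule dist_triangle)
    also have "dist y (y + t *\<^sub>R b) = \<bar>t\<bar>" using nb by (simp add: dist_norm)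
    finally show ?thesis using that h by simp
  qed
  \<comment> \<open>The opposite signs found at the ends of the segment around \<open>x\<close> form
    an open condition on its midpoint, so they persist for all \<open>y\<close> near
    \<open>x\<close>.\<close>
  define W where "W = {y\<in>ball x (r / 2). 0 < \<psi> (y + h *\<^sub>R b)} \<inter>
    {y\<in>ball x (r / 2). 0 < - \<psi> (y + (- h) *\<^sub>R b)}"
  have contW: "continuous_on (ball x (r / 2)) (\<lambda>y. \<psi> (y + t *\<^sub>R b))" if "\<bar>t\<bar> \<le> h" for t
    by (rule continuous_on_compose2[OF cont]) (use inball that r in \<open>auto intro!: continuous_intros\<close>)
  have "open W"
    unfolding W_def using h(1)
    by (intro open_Int open_superlevel continuous_on_minus contW) auto
  moreover have "x \<in> W" using d1(2) d2(2) h r by (simp add: W_def)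
  moreover have "W \<subseteq> {z + t *\<^sub>R b | z t. z \<in> S \<inter> V \<and> \<bar>t\<bar> \<le> 1}"
  proof
    fix y assume y: "y \<in> W"
    then have yb: "y \<in> ball x (r / 2)" by (simp add: W_def)
    have "\<exists>t\<ge>- h. t \<le> h \<and> \<psi> (y + t *\<^sub>R b) = 0"
    proof (rule IVT')
      show "continuous_on {- h..h} (\<lambda>t. \<psi> (y + t *\<^sub>R b))"
      proof (rule continuous_on_compose2[OF cont])
        show "(\<lambda>t. y + t *\<^sub>R b) ` {- h..h} \<subseteq> U"
        proof (rule image_subsetI)
          fix t assume "t \<in> {- h..h}"
          then have "y + t *\<^sub>R b \<in> ball x r" by (intro inball[OF yb]) auto
          then show "y + t *\<^sub>R b \<in> U" using r by blast
        qed
      qed (intro continuous_intros)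
    qed (use y h in \<open>auto simp: W_def\<close>)
    then obtain t where t: "\<bar>t\<bar> \<le> h" "\<psi> (y + t *\<^sub>R b) = 0"
      by (metis abs_le_iff minus_le_iff)
    have "y + t *\<^sub>R b \<in> S \<inter> V" using inball[OF yb t(1)] r U(4) t(2) by (auto simp: zero)
    then show "y \<in> {z + t *\<^sub>R b | z t. z \<in> S \<inter> V \<and> \<bar>t\<bar> \<le> 1}"
      \<comment> \<open>The zero \<open>z = y + t b\<close> lies in \<open>S \<inter> V\<close>, and
        \<open>y\<close> is recovered from it by the shift \<open>- t\<close>.\<close>
      using t(1) h by (intro CollectI exI[of _ "y + t *\<^sub>R b"] exI[of _ "- t"]) auto
  qed
  ultimately show False
    using negligible_thickened[OF b(1) null] negligible_subset open_not_negligible by blast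
qed

section \<open>Pointwise bounds on the piecewise smooth boundary\<close>

lemma sets_hausdorff_measure [simp]: "sets (hausdorff_measure s :: 'a::metric_space measure) = sets borel"
  using sets.sigma_sets_eq[of "borel :: 'a measure"] by (simp add: hausdorff_measure_def)

lemma space_hausdorff_measure [simp]: "space (hausdorff_measure s) = UNIV"
  by (simp add: hausdorff_measure_def)

text \<open>A violation at \<open>x\<close> spreads to the relatively open set
  \<open>V \<inter> \<Gamma>\<close>, which contains a relatively open nonempty part of a smooth
  hypersurface and therefore has positive area.\<close>

lemma continuous_le_if_AE_le_surface:
  fixes g :: "'a::euclidean_space \<Rightarrow> real"
  assumes \<Gamma>: "piecewise_smooth \<Gamma>" and g: "continuous_on \<Gamma> g"
    and AE: "AE x in surface_on \<Gamma>. g x \<le> C" and x: "x \<in> \<Gamma>"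
  shows "g x \<le> C"
proof (rule ccontr)
  assume neg: "\<not> g x \<le> C"
  let ?s = "DIM('a) - 1"
  obtain \<P> where \<P>: "finite \<P>" "\<Gamma> = \<Union>\<P>" and
    *: "\<forall>P\<in>\<P>. P \<in> sets borel \<and>
       (\<exists>S. smooth_hypersurface S \<and> S \<subseteq> P \<and> P \<subseteq> closure S \<and>
          hausdorff_outer ?s S < \<infinity> \<and> hausdorff_outer ?s (closure S - S) = 0)"
    using \<Gamma> unfolding piecewise_smooth_def by (elim exE conjE)
  \<comment> \<open>Measurability of the boundary lets the almost-everywhere bound on the restricted
    space be read as one for the full Hausdorff measure.\<close>
  have "\<Gamma> \<in> sets borel" using \<P> * by (auto intro!: sets.finite_Union)
  then have "\<Gamma> \<inter> space (hausdorff_measure ?s) \<in> sets (hausdorff_measure ?s)" by simp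
  then have "AE y in hausdorff_measure ?s. y \<in> \<Gamma> \<longrightarrow> g y \<le> C"
    using AE unfolding surface_on_def by (rule AE_restrict_space_iff[THEN iffD1])
  then obtain N where N: "{y. \<not> (y \<in> \<Gamma> \<longrightarrow> g y \<le> C)} \<subseteq> N" "N \<in> sets borel"
    "emeasure (hausdorff_measure ?s) N = 0"
    by (auto elim!: AE_E)
  then have N0: "hausdorff_outer ?s N = 0" by (simp add: emeasure_hausdorff_measure)
  obtain V where V: "open V" "V \<inter> \<Gamma> = g -` {C<..} \<inter> \<Gamma>"
    using g unfolding continuous_on_open_invariant by (metis open_greaterThan)
  obtain P where P: "P \<in> \<P>" "x \<in> P" using x \<P>(2) by blast
  obtain S where S: "smooth_hypersurface S" "S \<subseteq> P" "P \<subseteq> closure S"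
    using bspec[OF * P(1)] by (elim conjE exE)
  have "x \<in> V" using V neg x by auto
  \<comment> \<open>\<open>x\<close> may lie on the edge of its piece, outside the hypersurface
    \<open>S\<close>. As \<open>x\<close> is in the closure of \<open>S\<close>, the open set
    \<open>V\<close> still meets \<open>S\<close>, and the argument continues at
    \<open>y\<close>.\<close>
  then obtain y where y: "y \<in> S" "y \<in> V"
    using P S(3) V(1) open_Int_closure_eq_empty[of V S] by blast
  have "S \<inter> V \<subseteq> N"
  proof
    fix z assume z: "z \<in> S \<inter> V"
    then have "z \<in> V \<inter> \<Gamma>" using S(2) P(1) \<P>(2) by blast
    then show "z \<in> N" using V(2) N(1) by auto
  qed
  \<comment> \<open>Monotonicity of the outer measure applies directly, with no measurability
    argument for \<open>S \<inter> V\<close>.\<close>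
  then have "hausdorff_outer ?s (S \<inter> V) \<le> 0" using hausdorff_outer_mono N0 by metis
  then show False using hausdorff_outer_hypersurface_pos[OF S(1) V(1) y] by simp
qed

section \<open>Stability of the network\<close>

lemma spectral_norm_nonneg: "0 \<le> spectral_norm B"
  by (simp add: spectral_norm_def onorm_pos_le matrix_vector_mul_bounded_linear)

lemma norm_matrix_vector_le:
  assumes "spectral_norm B \<le> c"
  shows "norm (B *v v) \<le> c * norm v"
proof -
  have "norm (B *v v) \<le> spectral_norm B * norm v"
    unfolding spectral_norm_def by (rule onorm[OF matrix_vector_mul_bounded_linear])
  also have "\<dots> \<le> c * norm v" using assms by (intro mult_right_mono) auto
  finally show ?thesis .
qed

lemma spectral_norm_triangle: "spectral_norm B \<le> spectral_norm (B - B') + spectral_norm B'"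
proof -
  have "(*v) B = (\<lambda>v. (B - B') *v v + B' *v v)"
    by (simp add: fun_eq_iff flip: matrix_vector_mult_add_rdistrib)
  then show ?thesis
    unfolding spectral_norm_def
    using onorm_triangle[OF matrix_vector_mul_bounded_linear matrix_vector_mul_bounded_linear,
        of "B - B'" B'] by simp
qed

lemma sense_diff: "sense X (\<lambda>y. f y - g y) = sense X f - sense X g"
  by (simp add: sense_def vec_eq_iff)

lemma norm_sense_le:
  fixes X :: "'k::finite \<Rightarrow> 'a"
  assumes "\<And>i. \<bar>g (X i)\<bar> \<le> C"
  shows "norm (sense X g) \<le> real CARD('k) * C"
proof -
  have "norm (sense X g) \<le> (\<Sum>i\<in>UNIV. \<bar>g (X i)\<bar>)"
    using norm_le_l1_cart[of "sense X g"] by (simp add: sense_def)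
  also have "\<dots> \<le> real CARD('k) * C"
    using sum_bounded_above[of UNIV "\<lambda>i. \<bar>g (X i)\<bar>" C] assms by simp
  finally show ?thesis .
qed

lemma varmion_in_L2: "(\<And>i. \<tau> i \<in> L2 M) \<Longrightarrow> varmion D A A' \<tau> z \<in> L2 M"
  by (cases z) (simp add: varmion_def L2_inner_vec)

text \<open>With \<open>c = A F + A' N\<close> and \<open>c'\<close> defined likewise, the
  coefficient difference splits as
  \<open>(D \<Theta> - D \<Theta>') c + D \<Theta>' (c - c')\<close>. The first term uses the
  Lipschitz property of the branch, the second its boundedness.\<close>

lemma varmion_dist_le:
  assumes \<tau>: "\<And>i. \<tau> i \<in> L2 M" "L2_set (\<lambda>i. L2_norm M (\<tau> i)) UNIV \<le> C\<^sub>\<tau>"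
    and A: "spectral_norm A \<le> C\<^sub>A" "spectral_norm A' \<le> C\<^sub>A'"
    and D: "spectral_norm (D \<Theta> - D \<Theta>') \<le> \<delta>" "spectral_norm (D \<Theta>') \<le> B"
  shows "L2_dist M (varmion D A A' \<tau> (F, \<Theta>, N)) (varmion D A A' \<tau> (F', \<Theta>', N'))
    \<le> (\<delta> * (C\<^sub>A * norm F + C\<^sub>A' * norm N) + B * (C\<^sub>A * norm (F - F') + C\<^sub>A' * norm (N - N'))) * C\<^sub>\<tau>"
proof -
  let ?c = "(D \<Theta> - D \<Theta>') *v (A *v F + A' *v N) + D \<Theta>' *v (A *v (F - F') + A' *v (N - N'))"
  have "varmion D A A' \<tau> (F, \<Theta>, N) y - varmion D A A' \<tau> (F', \<Theta>', N') y = ?c \<bullet> (\<chi> i. \<tau> i y)" for y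
    by (simp add: varmion_def matrix_vector_mul_assoc matrix_vector_right_distrib
        matrix_vector_mult_diff_distrib matrix_vector_mult_diff_rdistrib inner_diff_left
        inner_add_left flip: matrix_vector_mul_assoc)
  then have "L2_dist M (varmion D A A' \<tau> (F, \<Theta>, N)) (varmion D A A' \<tau> (F', \<Theta>', N'))
      \<le> norm ?c * L2_set (\<lambda>i. L2_norm M (\<tau> i)) UNIV"
    using L2_norm_inner_vec_le[OF \<tau>(1)] by (simp add: L2_dist_def)
  also have "\<dots> \<le> norm ?c * C\<^sub>\<tau>" using \<tau>(2) by (intro mult_left_mono) auto
  also have "\<dots> \<le> (\<delta> * (C\<^sub>A * norm F + C\<^sub>A' * norm N)
      + B * (C\<^sub>A * norm (F - F') + C\<^sub>A' * norm (N - N'))) * C\<^sub>\<tau>"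
  proof (rule mult_right_mono)
    have "0 \<le> \<delta>" "0 \<le> B" using D spectral_norm_nonneg order_trans by blast+
    have AA': "norm (A *v u + A' *v v) \<le> C\<^sub>A * norm u + C\<^sub>A' * norm v" for u v
      by (intro norm_triangle_le add_mono norm_matrix_vector_le A)
    have "norm ((D \<Theta> - D \<Theta>') *v (A *v F + A' *v N)) \<le> \<delta> * (C\<^sub>A * norm F + C\<^sub>A' * norm N)"
      using AA' \<open>0 \<le> \<delta>\<close> by (rule order_trans[OF norm_matrix_vector_le[OF D(1)] mult_left_mono])
    moreover have "norm (D \<Theta>' *v (A *v (F - F') + A' *v (N - N')))
        \<le> B * (C\<^sub>A * norm (F - F') + C\<^sub>A' * norm (N - N'))"
      using AA' \<open>0 \<le> B\<close> by (rule order_trans[OF norm_matrix_vector_le[OF D(2)] mult_left_mono])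
    ultimately show "norm ?c \<le> \<delta> * (C\<^sub>A * norm F + C\<^sub>A' * norm N)
        + B * (C\<^sub>A * norm (F - F') + C\<^sub>A' * norm (N - N'))"
      by (intro norm_triangle_le add_mono)
    show "0 \<le> C\<^sub>\<tau>" using L2_set_nonneg \<tau>(2) order_trans by blast
  qed
  finally show ?thesis .
qed

text \<open>The first summand is the Lipschitz constant times a bound for \<open>A F + A' N\<close>.
  The factor \<open>\<bar>L\<^sub>D\<bar> * (2 * real k * C\<^sub>T) + C\<^sub>D\<close> bounds the
  branch on all sensed coefficients: two of them differ by at most
  \<open>2 * real k * C\<^sub>T\<close>. The absolute value is taken because no sign is assumed for
  \<open>L\<^sub>D\<close>.\<close>

definition network_constant ::
    "real \<Rightarrow> real \<Rightarrow> real \<Rightarrow> real \<Rightarrow> real \<Rightarrow> real \<Rightarrow> nat \<Rightarrow> nat \<Rightarrow> real \<Rightarrow> real \<Rightarrow> real" where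
  "network_constant C\<^sub>F C\<^sub>T C\<^sub>N C\<^sub>A C\<^sub>A' C\<^sub>\<tau> k kb L\<^sub>D C\<^sub>D =
     (\<bar>L\<^sub>D\<bar> * (C\<^sub>A * (real k * C\<^sub>F) + C\<^sub>A' * (real kb * C\<^sub>N))
      + (\<bar>L\<^sub>D\<bar> * (2 * real k * C\<^sub>T) + C\<^sub>D) * (C\<^sub>A + C\<^sub>A')) * C\<^sub>\<tau>"

lemma network_stable_varmion:
  fixes X :: "'k::finite \<Rightarrow> 'a::euclidean_space" and Xb :: "'kb::finite \<Rightarrow> 'a"
  assumes F: "\<And>f i. f \<in> \<F> \<Longrightarrow> \<bar>f (X i)\<bar> \<le> C\<^sub>F"
    and T: "\<And>\<theta> i. \<theta> \<in> \<T> \<Longrightarrow> \<bar>\<theta> (X i)\<bar> \<le> C\<^sub>T"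
    and N: "\<And>\<eta> i. \<eta> \<in> \<N> \<Longrightarrow> \<bar>\<eta> (Xb i)\<bar> \<le> C\<^sub>N"
    and \<tau>: "\<And>i. \<tau> i \<in> L2 (lebesgue_on \<Omega>)"
      "L2_set (\<lambda>i. L2_norm (lebesgue_on \<Omega>) (\<tau> i)) UNIV \<le> C\<^sub>\<tau>"
    and A: "spectral_norm A \<le> C\<^sub>A" "spectral_norm A' \<le> C\<^sub>A'"
    and lip: "\<And>\<Theta> \<Theta>'. \<Theta> \<in> sense X ` \<T> \<Longrightarrow> \<Theta>' \<in> sense X ` \<T> \<Longrightarrow>
      spectral_norm (D \<Theta> - D \<Theta>') \<le> L\<^sub>D * norm (\<Theta> - \<Theta>')"
    and \<Theta>\<^sub>0: "\<Theta>\<^sub>0 \<in> sense X ` \<T>" "spectral_norm (D \<Theta>\<^sub>0) \<le> C\<^sub>D"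
  shows "network_stable \<Omega> X Xb (varmion D A A' \<tau>) (\<F> \<times> \<T> \<times> \<N>)
    (network_constant C\<^sub>F C\<^sub>T C\<^sub>N C\<^sub>A C\<^sub>A' C\<^sub>\<tau> CARD('k) CARD('kb) L\<^sub>D C\<^sub>D)"
  unfolding network_stable_def
proof clarify
  fix f \<theta> \<eta> f' \<theta>' \<eta>'
  assume in_data: "f \<in> \<F>" "\<theta> \<in> \<T>" "\<eta> \<in> \<N>" "f' \<in> \<F>" "\<theta>' \<in> \<T>" "\<eta>' \<in> \<N>"
  let ?F = "sense X f" and ?F' = "sense X f'" and ?\<Theta> = "sense X \<theta>" and ?\<Theta>' = "sense X \<theta>'"
    and ?N = "sense Xb \<eta>" and ?N' = "sense Xb \<eta>'"
  define a n B where "a = real CARD('k) * C\<^sub>F" and "n = real CARD('kb) * C\<^sub>N"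
    and "B = \<bar>L\<^sub>D\<bar> * (2 * real CARD('k) * C\<^sub>T) + C\<^sub>D"
  define df dt dn where "df = norm (?F - ?F')" and "dt = norm (?\<Theta> - ?\<Theta>')" and "dn = norm (?N - ?N')"
  have nonneg: "0 \<le> C\<^sub>A" "0 \<le> C\<^sub>A'" "0 \<le> C\<^sub>\<tau>"
    using A spectral_norm_nonneg \<tau>(2) L2_set_nonneg order_trans by blast+
  have d: "0 \<le> df" "0 \<le> dt" "0 \<le> dn" by (auto simp: df_def dt_def dn_def)
  have Fa: "norm ?F \<le> a" unfolding a_def by (rule norm_sense_le) (rule F[OF in_data(1)])
  have Nn: "norm ?N \<le> n" unfolding n_def by (rule norm_sense_le) (rule N[OF in_data(3)])
  have an: "0 \<le> a" "0 \<le> n" using Fa Nn norm_ge_zero order_trans by blast+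
  have lip': "spectral_norm (D \<Theta> - D \<Theta>') \<le> \<bar>L\<^sub>D\<bar> * norm (\<Theta> - \<Theta>')"
    if "\<Theta> \<in> sense X ` \<T>" "\<Theta>' \<in> sense X ` \<T>" for \<Theta> \<Theta>'
    by (rule order_trans[OF lip[OF that] mult_right_mono]) auto
  obtain \<theta>\<^sub>0 where \<theta>\<^sub>0: "\<theta>\<^sub>0 \<in> \<T>" "\<Theta>\<^sub>0 = sense X \<theta>\<^sub>0" using \<Theta>\<^sub>0(1) by auto
  have "norm (?\<Theta>' - \<Theta>\<^sub>0) \<le> norm ?\<Theta>' + norm \<Theta>\<^sub>0" by (rule norm_triangle_ineq4)
  also have "\<dots> \<le> real CARD('k) * C\<^sub>T + real CARD('k) * C\<^sub>T"
    unfolding \<theta>\<^sub>0(2) by (intro add_mono norm_sense_le T in_data \<theta>\<^sub>0)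
  finally have "\<bar>L\<^sub>D\<bar> * norm (?\<Theta>' - \<Theta>\<^sub>0) \<le> \<bar>L\<^sub>D\<bar> * (2 * real CARD('k) * C\<^sub>T)"
    by (intro mult_left_mono) (auto simp: algebra_simps)
  then have DB: "spectral_norm (D ?\<Theta>') \<le> B"
    unfolding B_def
    using spectral_norm_triangle[of "D ?\<Theta>'" "D \<Theta>\<^sub>0"] lip'[OF _ \<Theta>\<^sub>0(1), of ?\<Theta>'] in_data \<Theta>\<^sub>0(2) by force
  then have B: "0 \<le> B" using spectral_norm_nonneg order_trans by blast
  have "L2_dist (lebesgue_on \<Omega>) (varmion D A A' \<tau> (?F, ?\<Theta>, ?N)) (varmion D A A' \<tau> (?F', ?\<Theta>', ?N'))
      \<le> (\<bar>L\<^sub>D\<bar> * dt * (C\<^sub>A * norm ?F + C\<^sub>A' * norm ?N) + B * (C\<^sub>A * df + C\<^sub>A' * dn)) * C\<^sub>\<tau>"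
    unfolding df_def dt_def dn_def
    by (rule varmion_dist_le[OF \<tau> A lip'[of ?\<Theta> ?\<Theta>'] DB]) (use in_data in auto)
  \<comment> \<open>Each individual difference is enlarged to the sum of all three, so that this sum
    can be factored out.\<close>
  also have "\<dots> \<le> (\<bar>L\<^sub>D\<bar> * (df + dt + dn) * (C\<^sub>A * a + C\<^sub>A' * n)
      + B * (C\<^sub>A * (df + dt + dn) + C\<^sub>A' * (df + dt + dn))) * C\<^sub>\<tau>"
    using nonneg d an Fa Nn B by (intro mult_right_mono add_mono mult_mono mult_left_mono) auto
  also have "\<dots> = network_constant C\<^sub>F C\<^sub>T C\<^sub>N C\<^sub>A C\<^sub>A' C\<^sub>\<tau> CARD('k) CARD('kb) L\<^sub>D C\<^sub>D * (df + dt + dn)"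
    by (simp add: network_constant_def a_def n_def B_def algebra_simps)
  finally show "L2_dist (lebesgue_on \<Omega>) (varmion D A A' \<tau> (sensing X Xb (f, \<theta>, \<eta>)))
      (varmion D A A' \<tau> (sensing X Xb (f', \<theta>', \<eta>')))
      \<le> network_constant C\<^sub>F C\<^sub>T C\<^sub>N C\<^sub>A C\<^sub>A' C\<^sub>\<tau> CARD('k) CARD('kb) L\<^sub>D C\<^sub>D *
        (norm (?F - ?F') + norm (?\<Theta> - ?\<Theta>') + norm (?N - ?N'))"
    by (simp add: sensing_def df_def dt_def dn_def)
qed

section \<open>The generalization error\<close>

lemma sqrt_divide_powr:
  assumes "0 < n"
  shows "sqrt (C / n powr \<alpha>) = sqrt C / n powr (\<alpha> / 2)"
  using assms by (simp add: real_sqrt_divide powr_half_sqrt[symmetric] powr_powr)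

text \<open>Cost of passing from the weighted sum of squares in the quadrature to the unweighted
  Euclidean norm of the sensor vector.\<close>

definition sensor_factor :: "real^'k \<Rightarrow> real" where
  "sensor_factor w = 1 / sqrt (Min (range (($) w)))"

lemma sensor_factor_nonneg: "(\<And>i. 0 < w $ i) \<Longrightarrow> 0 \<le> sensor_factor w"
  by (auto simp: sensor_factor_def intro!: less_imp_le)

text \<open>The smallest weight times the squared Euclidean norm is at most the quadrature sum,
  hence at most the squared \<open>L2\<close> norm plus the quadrature error. Subadditivity of the
  square root separates the two and halves the exponent.\<close>

lemma norm_sense_le_quadrature:
  fixes X :: "'k::finite \<Rightarrow> 'a"
  assumes w: "\<And>i. 0 < w $ i"
    and quad: "\<bar>(\<Sum>i\<in>UNIV. w $ i * (g (X i))\<^sup>2) - (LINT y|M. (g y)\<^sup>2)\<bar> \<le> c / n powr \<alpha>"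
    and c: "c \<le> C" and n: "0 < n"
  shows "norm (sense X g) \<le> sensor_factor w * (L2_norm M g + sqrt \<bar>C\<bar> / n powr (\<alpha> / 2))"
proof -
  define m where "m = Min (range (($) w))"
  \<comment> \<open>The absolute value keeps the error term nonnegative, as needed for splitting the
    square root.\<close>
  define E where "E = \<bar>C\<bar> / n powr \<alpha>"
  have m: "0 < m" "m \<le> w $ i" for i using w by (auto simp: m_def)
  have "m * (norm (sense X g))\<^sup>2 = (\<Sum>i\<in>UNIV. m * (g (X i))\<^sup>2)"
    by (simp add: sense_def norm_vec_def L2_set_def sum_nonneg sum_distrib_left)
  also have "\<dots> \<le> (\<Sum>i\<in>UNIV. w $ i * (g (X i))\<^sup>2)"
    using m by (intro sum_mono mult_right_mono) auto
  also have "\<dots> \<le> (L2_norm M g)\<^sup>2 + c / n powr \<alpha>"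
    using quad by (simp add: L2_norm_power2)
  also have "\<dots> \<le> (L2_norm M g)\<^sup>2 + E"
    unfolding E_def using c n by (intro add_left_mono divide_right_mono) auto
  finally have "sqrt (m * (norm (sense X g))\<^sup>2) \<le> sqrt ((L2_norm M g)\<^sup>2 + E)" by simp
  also have "\<dots> \<le> sqrt ((L2_norm M g)\<^sup>2) + sqrt E"
    by (rule sqrt_add_le_add_sqrt) (use n in \<open>auto simp: E_def\<close>)
  finally show ?thesis
    using m(1) n by (simp add: real_sqrt_mult E_def sqrt_divide_powr sensor_factor_def
        field_simps flip: m_def)
qed

text \<open>The 3 counts the data components in the stability of the solution operator. The factors
  2 and 1 reflect that two components are sensed in the interior and one on the boundary.\<close>

definition covering_constant ::
    "real \<Rightarrow> real \<Rightarrow> real^'k \<Rightarrow> real^'kb \<Rightarrow> real \<Rightarrow> real \<Rightarrow> real \<Rightarrow> real" where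
  "covering_constant C K w wb q\<^sub>F q\<^sub>T q\<^sub>N = 3 * \<bar>C\<bar> + \<bar>K\<bar> * (2 * sensor_factor w + sensor_factor wb)"

text \<open>The terms multiplied by \<open>\<bar>K\<bar>\<close> are sensor quadrature errors
  propagated by the network; \<open>sqrt \<bar>q\<bar>\<close> is the output quadrature error on the
  training samples.\<close>

definition quadrature_constant ::
    "real \<Rightarrow> real \<Rightarrow> real^'k \<Rightarrow> real^'kb \<Rightarrow> real \<Rightarrow> real \<Rightarrow> real \<Rightarrow> real \<Rightarrow> real" where
  "quadrature_constant C K w wb q\<^sub>F q\<^sub>T q\<^sub>N q =
     \<bar>K\<bar> * (sensor_factor w * (sqrt \<bar>q\<^sub>F\<bar> + sqrt \<bar>q\<^sub>T\<bar>) + sensor_factor wb * sqrt \<bar>q\<^sub>N\<bar>) + sqrt \<bar>q\<bar>"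

section \<open>Membership in \<open>L2\<close> and bounds at the sensors\<close>

lemma weak_solution_in_L2: "weak_solution \<Omega> \<Gamma>\<^sub>g \<Gamma>\<^sub>\<eta> \<kappa> f \<eta> u \<Longrightarrow> u \<in> L2 (lebesgue_on \<Omega>)"
  by (simp add: weak_solution_def H1_zero_on_def H1_def)

lemma discrete_solution_in_L2:
  assumes "fe_basis \<Omega> \<phi>"
  shows "discrete_solution \<Omega> \<Gamma>\<^sub>\<eta> \<kappa> \<phi> d \<in> L2 (lebesgue_on \<Omega>)"
proof -
  have "fe_fun \<phi> c \<in> L2 (lebesgue_on \<Omega>)" for c
    unfolding fe_fun_def by (rule L2_inner_vec) (use assms in \<open>simp add: fe_basis_def H1_def\<close>)
  then show ?thesis by (cases d) (simp add: discrete_solution_def)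
qed

lemma finite_measure_domain: "domain_with_boundary \<Omega> \<Gamma>\<^sub>g \<Gamma>\<^sub>\<eta> \<Longrightarrow> finite_measure (lebesgue_on \<Omega>)"
  by (simp add: domain_with_boundary_def finite_measure_lebesgue_on lmeasurable_open)

lemma interior_value_le:
  assumes "open \<Omega>" "continuous_on \<Omega> f" "Linf_norm (lebesgue_on \<Omega>) f \<le> ereal C" "x \<in> \<Omega>"
  shows "\<bar>f x\<bar> \<le> C"
  by (rule continuous_le_if_AE_le_open[OF assms(1) _ Linf_norm_AE[OF assms(3)] assms(4)])
     (use assms(2) in \<open>intro continuous_intros\<close>)

lemma boundary_value_le:
  assumes "piecewise_smooth \<Gamma>" "continuous_on \<Gamma> f" "Linf_norm (surface_on \<Gamma>) f \<le> ereal C" "x \<in> \<Gamma>"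
  shows "\<bar>f x\<bar> \<le> C"
  by (rule continuous_le_if_AE_le_surface[OF assms(1) _ Linf_norm_AE[OF assms(3)] assms(4)])
     (use assms(2) in \<open>intro continuous_intros\<close>)

text \<open>Quadrature applied to the difference \<open>f - f'\<close>; taking the supremum of its
  constants over all pairs makes the bound independent of the datum and of the nearby
  sample.\<close>

lemma sense_diff_le:
  fixes X :: "'k::finite \<Rightarrow> 'a"
  assumes w: "\<And>i. 0 < w $ i"
    and quad: "\<forall>g\<in>L2 M. \<bar>(\<Sum>i\<in>UNIV. w $ i * (g (X i))\<^sup>2) - (LINT y|M. (g y)\<^sup>2)\<bar>
      \<le> CQ g / real CARD('k) powr \<alpha>"
    and bdd: "bdd_above ((\<lambda>(f, f'). CQ (\<lambda>y. f y - f' y)) ` (\<F> \<times> \<F>))"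
    and q: "q = (SUP (f, f')\<in>\<F> \<times> \<F>. CQ (\<lambda>y. f y - f' y))"
    and f: "f \<in> \<F>" "f' \<in> \<F>" and L2: "\<F> \<subseteq> L2 M" and dist: "L2_dist M f f' \<le> \<epsilon>"
  shows "norm (sense X f - sense X f') \<le> sensor_factor w * (\<epsilon> + sqrt \<bar>q\<bar> / real CARD('k) powr (\<alpha> / 2))"
proof -
  have "(\<lambda>y. f y - f' y) \<in> L2 M" by (rule L2_diff) (use f L2 in auto)
  then have quad': "\<bar>(\<Sum>i\<in>UNIV. w $ i * (f (X i) - f' (X i))\<^sup>2) - (LINT y|M. (f y - f' y)\<^sup>2)\<bar>
      \<le> CQ (\<lambda>y. f y - f' y) / real CARD('k) powr \<alpha>"
    using quad by auto
  have "CQ (\<lambda>y. f y - f' y) \<le> q"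
    unfolding q using cSUP_upper[OF _ bdd, of "(f, f')"] f by simp
  then have "norm (sense X (\<lambda>y. f y - f' y))
      \<le> sensor_factor w * (L2_norm M (\<lambda>y. f y - f' y) + sqrt \<bar>q\<bar> / real CARD('k) powr (\<alpha> / 2))"
    by (intro norm_sense_le_quadrature[OF w quad']) auto
  also have "\<dots> \<le> sensor_factor w * (\<epsilon> + sqrt \<bar>q\<bar> / real CARD('k) powr (\<alpha> / 2))"
    using dist by (intro mult_left_mono sensor_factor_nonneg w) (simp add: L2_dist_def)
  finally show ?thesis by (simp add: sense_diff)
qed

text \<open>The estimate at a single datum, for an arbitrary stability constant \<open>Cnet\<close>
  of the network, so that it is separate from the construction of that constant.\<close>

lemma generalization_error_le:
  fixes X :: "'k::finite \<Rightarrow> 'a::euclidean_space" and Xb :: "'kb::finite \<Rightarrow> 'a"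
    and L J :: nat
  assumes dom: "domain_with_boundary \<Omega> \<Gamma>\<^sub>g \<Gamma>\<^sub>\<eta>" and spaces: "data_spaces \<Omega> \<Gamma>\<^sub>\<eta> \<F> \<T> \<N>"
    and sol: "solution_operator \<Omega> \<Gamma>\<^sub>g \<Gamma>\<^sub>\<eta> \<kappa> (\<F> \<times> \<T> \<times> \<N>) \<S>"
    and fe: "fe_basis \<Omega> \<phi>" and \<S>\<^sub>h: "\<S>\<^sub>h = discrete_solution \<Omega> \<Gamma>\<^sub>\<eta> \<kappa> \<phi>"
    and \<tau>: "\<forall>i. \<tau> i \<in> L2 (lebesgue_on \<Omega>)" and NN: "NN = varmion D A A' \<tau>"
    and L: "1 \<le> L"
    and quadL: "\<forall>g\<in>L2 (lebesgue_on \<Omega>).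
      \<bar>(\<Sum>l=1..L. w l * (g (x l))\<^sup>2) - (LINT y|lebesgue_on \<Omega>. (g y)\<^sup>2)\<bar> \<le> CQ g / real L powr \<gamma>"
    and s: "\<forall>j\<in>{1..J}. s j \<in> \<F> \<times> \<T> \<times> \<N>"
    and err: "err = (\<lambda>j y. \<S>\<^sub>h (data_proj \<Omega> \<Gamma>\<^sub>\<eta> \<phi> (s j)) y - NN (sensing X Xb (s j)) y)"
    and stab: "\<forall>(f, \<theta>, \<eta>)\<in>\<F> \<times> \<T> \<times> \<N>. \<forall>(f', \<theta>', \<eta>')\<in>\<F> \<times> \<T> \<times> \<N>.
      L2_dist (lebesgue_on \<Omega>) (\<S> (f, \<theta>, \<eta>)) (\<S> (f', \<theta>', \<eta>'))
      \<le> Cstab * (L2_dist (lebesgue_on \<Omega>) f f' + L2_dist (lebesgue_on \<Omega>) \<theta> \<theta>'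
                  + L2_dist (surface_on \<Gamma>\<^sub>\<eta>) \<eta> \<eta>')"
    and \<epsilon>\<^sub>h: "0 < \<epsilon>\<^sub>h"
    and num: "\<forall>d\<in>\<F> \<times> \<T> \<times> \<N>.
      L2_dist (lebesgue_on \<Omega>) (\<S> d) (\<S>\<^sub>h (data_proj \<Omega> \<Gamma>\<^sub>\<eta> \<phi> d)) < C\<^sub>h d * \<epsilon>\<^sub>h"
    and ChS: "ChS = Max ((\<lambda>j. C\<^sub>h (s j)) ` {1..J})"
    and \<epsilon>\<^sub>s: "0 < \<epsilon>\<^sub>s"
    and cover: "\<forall>(f, \<theta>, \<eta>)\<in>\<F> \<times> \<T> \<times> \<N>. \<exists>j\<in>{1..J}. case s j of (f\<^sub>j, \<theta>\<^sub>j, \<eta>\<^sub>j) \<Rightarrow>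
      L2_dist (lebesgue_on \<Omega>) f f\<^sub>j < \<epsilon>\<^sub>s \<and> L2_dist (lebesgue_on \<Omega>) \<theta> \<theta>\<^sub>j < \<epsilon>\<^sub>s \<and>
      L2_dist (surface_on \<Gamma>\<^sub>\<eta>) \<eta> \<eta>\<^sub>j < \<epsilon>\<^sub>s"
    and \<epsilon>\<^sub>t: "0 < \<epsilon>\<^sub>t" and train: "\<forall>j\<in>{1..J}. (\<Sum>l=1..L. w l * (err j (x l))\<^sup>2) < \<epsilon>\<^sub>t"
    and ws: "\<forall>i. w\<^sub>s $ i > 0" and wbs: "\<forall>i. wb\<^sub>s $ i > 0"
    and quad: "\<forall>g\<in>L2 (lebesgue_on \<Omega>).
      \<bar>(\<Sum>i\<in>UNIV. w\<^sub>s $ i * (g (X i))\<^sup>2) - (LINT y|lebesgue_on \<Omega>. (g y)\<^sup>2)\<bar>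
      \<le> CsQ g / real CARD('k) powr \<alpha>"
    and quadb: "\<forall>g\<in>L2 (surface_on \<Gamma>\<^sub>\<eta>).
      \<bar>(\<Sum>i\<in>UNIV. wb\<^sub>s $ i * (g (Xb i))\<^sup>2) - (LINT y|surface_on \<Gamma>\<^sub>\<eta>. (g y)\<^sup>2)\<bar>
      \<le> CbQ g / real CARD('kb) powr \<alpha>'"
    and bddF: "bdd_above ((\<lambda>(f, f'). CsQ (\<lambda>y. f y - f' y)) ` (\<F> \<times> \<F>))"
    and bddT: "bdd_above ((\<lambda>(\<theta>, \<theta>'). CsQ (\<lambda>y. \<theta> y - \<theta>' y)) ` (\<T> \<times> \<T>))"
    and bddN: "bdd_above ((\<lambda>(\<eta>, \<eta>'). CbQ (\<lambda>y. \<eta> y - \<eta>' y)) ` (\<N> \<times> \<N>))"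
    and CQF: "CQF = (SUP (f, f')\<in>\<F> \<times> \<F>. CsQ (\<lambda>y. f y - f' y))"
    and CQT: "CQT = (SUP (\<theta>, \<theta>')\<in>\<T> \<times> \<T>. CsQ (\<lambda>y. \<theta> y - \<theta>' y))"
    and CQN: "CQN = (SUP (\<eta>, \<eta>')\<in>\<N> \<times> \<N>. CbQ (\<lambda>y. \<eta> y - \<eta>' y))"
    and CQS: "CQS = Max ((\<lambda>j. CQ (err j)) ` {1..J})"
    and net: "network_stable \<Omega> X Xb NN (\<F> \<times> \<T> \<times> \<N>) Cnet"
    and d: "d \<in> \<F> \<times> \<T> \<times> \<N>"
  shows "L2_dist (lebesgue_on \<Omega>) (\<S> d) (NN (sensing X Xb d))
    \<le> ChS * \<epsilon>\<^sub>h + covering_constant Cstab Cnet w\<^sub>s wb\<^sub>s CQF CQT CQN * \<epsilon>\<^sub>s + sqrt \<epsilon>\<^sub>t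
      + quadrature_constant Cstab Cnet w\<^sub>s wb\<^sub>s CQF CQT CQN CQS
        * (1 / real CARD('k) powr (\<alpha> / 2) + 1 / real CARD('kb) powr (\<alpha>' / 2)
           + 1 / real L powr (\<gamma> / 2))"
proof -
  let ?M = "lebesgue_on \<Omega>" and ?B = "surface_on \<Gamma>\<^sub>\<eta>"
  obtain f \<theta> \<eta> where d_eq: "d = (f, \<theta>, \<eta>)" and d_in: "f \<in> \<F>" "\<theta> \<in> \<T>" "\<eta> \<in> \<N>"
    using d by auto
  obtain j where j: "j \<in> {1..J}" and cj: "case s j of (f\<^sub>j, \<theta>\<^sub>j, \<eta>\<^sub>j) \<Rightarrow>
      L2_dist ?M f f\<^sub>j < \<epsilon>\<^sub>s \<and> L2_dist ?M \<theta> \<theta>\<^sub>j < \<epsilon>\<^sub>s \<and> L2_dist ?B \<eta> \<eta>\<^sub>j < \<epsilon>\<^sub>s"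
    using bspec[OF cover d] unfolding d_eq prod.case by (elim bexE)
  obtain f' \<theta>' \<eta>' where sj: "s j = (f', \<theta>', \<eta>')" by (cases "s j")
  have sj_in: "f' \<in> \<F>" "\<theta>' \<in> \<T>" "\<eta>' \<in> \<N>" using bspec[OF s j] by (auto simp: sj)
  have close: "L2_dist ?M f f' < \<epsilon>\<^sub>s" "L2_dist ?M \<theta> \<theta>' < \<epsilon>\<^sub>s" "L2_dist ?B \<eta> \<eta>' < \<epsilon>\<^sub>s"
    using cj by (auto simp: sj)
  have L2_data: "\<F> \<subseteq> L2 ?M" "\<T> \<subseteq> L2 ?M" "\<N> \<subseteq> L2 ?B"
    using spaces Linf_subset_L2[OF finite_measure_domain[OF dom]] by (auto simp: data_spaces_def)
  have S_L2: "\<S> d \<in> L2 ?M" "\<S> (s j) \<in> L2 ?M"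
    using sol d_in sj_in by (auto simp: solution_operator_def d_eq sj intro: weak_solution_in_L2)
  have Sh_L2: "\<S>\<^sub>h z \<in> L2 ?M" for z unfolding \<S>\<^sub>h by (rule discrete_solution_in_L2[OF fe])
  have NN_L2: "NN z \<in> L2 ?M" for z unfolding NN by (rule varmion_in_L2) (use \<tau> in simp)
  define a b c where "a = 1 / real CARD('k) powr (\<alpha> / 2)" and "b = 1 / real CARD('kb) powr (\<alpha>' / 2)"
    and "c = 1 / real L powr (\<gamma> / 2)"
  define p pb where "p = sensor_factor w\<^sub>s" and "pb = sensor_factor wb\<^sub>s"
  define qF qT qN qS where "qF = sqrt \<bar>CQF\<bar>" and "qT = sqrt \<bar>CQT\<bar>" and "qN = sqrt \<bar>CQN\<bar>"
    and "qS = sqrt \<bar>CQS\<bar>"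
  have nonneg: "0 \<le> a" "0 \<le> b" "0 \<le> c" "0 \<le> p" "0 \<le> pb" "0 \<le> qF" "0 \<le> qT" "0 \<le> qN" "0 \<le> qS"
    using ws wbs
    by (auto simp: a_def b_def c_def p_def pb_def qF_def qT_def qN_def qS_def sensor_factor_nonneg)
  \<comment> \<open>Constants such as \<open>Cstab\<close> carry no sign assumption, so absolute
    values are taken before the data distances are enlarged.\<close>
  have e1: "L2_dist ?M (\<S> d) (\<S> (s j)) \<le> \<bar>Cstab\<bar> * (3 * \<epsilon>\<^sub>s)"
  proof -
    let ?D = "L2_dist ?M f f' + L2_dist ?M \<theta> \<theta>' + L2_dist ?B \<eta> \<eta>'"
    have "L2_dist ?M (\<S> d) (\<S> (s j)) \<le> Cstab * ?D"
      using stab d_in sj_in by (auto simp: d_eq sj)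
    also have "\<dots> \<le> \<bar>Cstab\<bar> * ?D" by (intro mult_right_mono add_nonneg_nonneg) auto
    also have "\<dots> \<le> \<bar>Cstab\<bar> * (3 * \<epsilon>\<^sub>s)" using close by (intro mult_left_mono) auto
    finally show ?thesis .
  qed
  have e2: "L2_dist ?M (\<S> (s j)) (\<S>\<^sub>h (data_proj \<Omega> \<Gamma>\<^sub>\<eta> \<phi> (s j))) \<le> ChS * \<epsilon>\<^sub>h"
  proof -
    have "C\<^sub>h (s j) \<le> ChS" unfolding ChS using j by (intro Max_ge) auto
    then have "C\<^sub>h (s j) * \<epsilon>\<^sub>h \<le> ChS * \<epsilon>\<^sub>h" using \<epsilon>\<^sub>h by simp
    then show ?thesis using bspec[OF num bspec[OF s j]] by linarith
  qed
  \<comment> \<open>The output quadrature turns the discrete loss, below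
    \<open>\<epsilon>\<^sub>t\<close>, into a bound on the integral of the squared training
    error.\<close>
  have e3: "L2_dist ?M (\<S>\<^sub>h (data_proj \<Omega> \<Gamma>\<^sub>\<eta> \<phi> (s j))) (NN (sensing X Xb (s j))) \<le> sqrt \<epsilon>\<^sub>t + qS * c"
  proof -
    have err_L2: "err j \<in> L2 ?M" unfolding err by (rule L2_diff[OF Sh_L2 NN_L2])
    have "CQ (err j) \<le> \<bar>CQS\<bar>"
      unfolding CQS using j by (intro order_trans[OF Max_ge abs_ge_self]) auto
    then have "CQ (err j) / real L powr \<gamma> \<le> \<bar>CQS\<bar> / real L powr \<gamma>" by (rule divide_right_mono) simp
    then have "(LINT y|?M. (err j y)\<^sup>2) \<le> \<epsilon>\<^sub>t + \<bar>CQS\<bar> / real L powr \<gamma>"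
      using bspec[OF quadL err_L2] bspec[OF train j] by linarith
    then have "L2_norm ?M (err j) \<le> sqrt (\<epsilon>\<^sub>t + \<bar>CQS\<bar> / real L powr \<gamma>)"
      by (simp add: L2_norm_def)
    also have "\<dots> \<le> sqrt \<epsilon>\<^sub>t + sqrt (\<bar>CQS\<bar> / real L powr \<gamma>)"
      using \<epsilon>\<^sub>t by (intro sqrt_add_le_add_sqrt) auto
    also have "sqrt (\<bar>CQS\<bar> / real L powr \<gamma>) = qS * c"
      using L by (simp add: sqrt_divide_powr qS_def c_def)
    finally show ?thesis by (simp add: L2_dist_def err)
  qed
  have e4: "L2_dist ?M (NN (sensing X Xb (s j))) (NN (sensing X Xb d))
      \<le> \<bar>Cnet\<bar> * (p * (\<epsilon>\<^sub>s + qF * a) + p * (\<epsilon>\<^sub>s + qT * a) + pb * (\<epsilon>\<^sub>s + qN * b))"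
  proof -
    let ?D = "norm (sense X f - sense X f') + norm (sense X \<theta> - sense X \<theta>')
      + norm (sense Xb \<eta> - sense Xb \<eta>')"
    have "L2_dist ?M (NN (sensing X Xb (s j))) (NN (sensing X Xb d)) \<le> Cnet * ?D"
      using net d_in sj_in L2_dist_commute[of ?M "NN (sensing X Xb (s j))"]
      by (auto simp: network_stable_def d_eq sj)
    also have "\<dots> \<le> \<bar>Cnet\<bar> * ?D" by (intro mult_right_mono add_nonneg_nonneg) auto
    also have "\<dots> \<le> \<bar>Cnet\<bar> * (p * (\<epsilon>\<^sub>s + qF * a) + p * (\<epsilon>\<^sub>s + qT * a) + pb * (\<epsilon>\<^sub>s + qN * b))"
    proof (intro mult_left_mono add_mono)
      have ws': "0 < w\<^sub>s $ i" and wbs': "0 < wb\<^sub>s $ i'" for i i' using ws wbs by auto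
      show "norm (sense X f - sense X f') \<le> p * (\<epsilon>\<^sub>s + qF * a)"
        using sense_diff_le[OF ws' quad bddF CQF d_in(1) sj_in(1) L2_data(1) less_imp_le[OF close(1)]]
        by (simp add: p_def qF_def a_def)
      show "norm (sense X \<theta> - sense X \<theta>') \<le> p * (\<epsilon>\<^sub>s + qT * a)"
        using sense_diff_le[OF ws' quad bddT CQT d_in(2) sj_in(2) L2_data(2) less_imp_le[OF close(2)]]
        by (simp add: p_def qT_def a_def)
      show "norm (sense Xb \<eta> - sense Xb \<eta>') \<le> pb * (\<epsilon>\<^sub>s + qN * b)"
        using sense_diff_le[OF wbs' quadb bddN CQN d_in(3) sj_in(3) L2_data(3) less_imp_le[OF close(3)]]
        by (simp add: pb_def qN_def b_def)
    qed simp
    finally show ?thesis .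
  qed
  have "L2_dist ?M (\<S> d) (NN (sensing X Xb d))
      \<le> L2_dist ?M (\<S> d) (\<S> (s j)) + L2_dist ?M (\<S> (s j)) (\<S>\<^sub>h (data_proj \<Omega> \<Gamma>\<^sub>\<eta> \<phi> (s j)))
        + L2_dist ?M (\<S>\<^sub>h (data_proj \<Omega> \<Gamma>\<^sub>\<eta> \<phi> (s j))) (NN (sensing X Xb (s j)))
        + L2_dist ?M (NN (sensing X Xb (s j))) (NN (sensing X Xb d))"
    using L2_dist_triangle[OF S_L2 NN_L2[of "sensing X Xb d"]]
      L2_dist_triangle[OF S_L2(2) Sh_L2[of "data_proj \<Omega> \<Gamma>\<^sub>\<eta> \<phi> (s j)"] NN_L2[of "sensing X Xb d"]]
      L2_dist_triangle[OF Sh_L2[of "data_proj \<Omega> \<Gamma>\<^sub>\<eta> \<phi> (s j)"] NN_L2[of "sensing X Xb (s j)"]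
        NN_L2[of "sensing X Xb d"]]
    by linarith
  also have "\<dots> \<le> ChS * \<epsilon>\<^sub>h + (3 * \<bar>Cstab\<bar> + \<bar>Cnet\<bar> * (2 * p + pb)) * \<epsilon>\<^sub>s + sqrt \<epsilon>\<^sub>t
      + (\<bar>Cnet\<bar> * (p * (qF + qT)) * a + \<bar>Cnet\<bar> * (pb * qN) * b + qS * c)"
    using e1 e2 e3 e4 by (simp add: algebra_simps)
  \<comment> \<open>Each of the three rates \<open>a\<close>, \<open>b\<close>, \<open>c\<close> is
    enlarged to their sum, which yields one common constant in front.\<close>
  also have "\<bar>Cnet\<bar> * (p * (qF + qT)) * a + \<bar>Cnet\<bar> * (pb * qN) * b + qS * c
      \<le> \<bar>Cnet\<bar> * (p * (qF + qT)) * (a + b + c) + \<bar>Cnet\<bar> * (pb * qN) * (a + b + c) + qS * (a + b + c)"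
    using nonneg by (intro add_mono mult_left_mono) auto
  also have "\<dots> = (\<bar>Cnet\<bar> * (p * (qF + qT) + pb * qN) + qS) * (a + b + c)"
    by (simp add: algebra_simps)
  finally show ?thesis
    by (simp add: covering_constant_def quadrature_constant_def a_def b_def c_def p_def pb_def
        qF_def qT_def qN_def qS_def)
qed

theorem theorem4p2:
  "\<exists>(Cstab_net :: real \<Rightarrow> real \<Rightarrow> real \<Rightarrow> real \<Rightarrow> real \<Rightarrow> real \<Rightarrow> nat \<Rightarrow> nat \<Rightarrow> real \<Rightarrow> real \<Rightarrow> real)
    (CS_bar :: real \<Rightarrow> real \<Rightarrow> real^'k \<Rightarrow> real^'kb \<Rightarrow> real \<Rightarrow> real \<Rightarrow> real \<Rightarrow> real)
    (CQ_bar :: real \<Rightarrow> real \<Rightarrow> real^'k \<Rightarrow> real^'kb \<Rightarrow> real \<Rightarrow> real \<Rightarrow> real \<Rightarrow> real \<Rightarrow> real).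
   \<forall>(\<Omega> :: 'a::euclidean_space set) \<Gamma>\<^sub>g \<Gamma>\<^sub>\<eta> \<F> \<T> \<N> \<X> (\<kappa> :: ('a \<Rightarrow> real) \<Rightarrow> 'a coeffs) \<S>
    (\<phi> :: 'q::finite \<Rightarrow> 'a \<Rightarrow> real) \<S>\<^sub>h
    (X :: 'k::finite \<Rightarrow> 'a) (Xb :: 'kb::finite \<Rightarrow> 'a) w\<^sub>s wb\<^sub>s
    (D :: real^'k \<Rightarrow> real^'p^'p) A A' \<tau> NN
    (L :: nat) (x :: nat \<Rightarrow> 'a) (w :: nat \<Rightarrow> real) CQ \<gamma>
    (J :: nat) (s :: nat \<Rightarrow> 'a datum) err
    Cstab C\<^sub>h \<epsilon>\<^sub>h \<epsilon>\<^sub>s \<epsilon>\<^sub>t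
    C\<^sub>F C\<^sub>T C\<^sub>N C\<^sub>A C\<^sub>A' C\<^sub>\<tau> L\<^sub>D \<Theta>\<^sub>0 C\<^sub>D
    CsQ CbQ \<alpha> \<alpha>' CQF CQT CQN CQS ChS Cnet.
     \<comment> \<open>boundary value problem\<close>
     domain_with_boundary \<Omega> \<Gamma>\<^sub>g \<Gamma>\<^sub>\<eta> \<and> data_spaces \<Omega> \<Gamma>\<^sub>\<eta> \<F> \<T> \<N> \<and> \<X> = \<F> \<times> \<T> \<times> \<N> \<and>
     (\<forall>\<theta>\<in>\<T>. elliptic \<Omega> (\<kappa> \<theta>)) \<and> well_posed \<Omega> \<Gamma>\<^sub>g \<Gamma>\<^sub>\<eta> \<kappa> \<X> \<and>
     solution_operator \<Omega> \<Gamma>\<^sub>g \<Gamma>\<^sub>\<eta> \<kappa> \<X> \<S> \<and>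
     \<comment> \<open>numerical solver\<close>
     fe_basis \<Omega> \<phi> \<and>
     (\<forall>\<theta>\<in>\<T>. invertible (stiffness_matrix \<Omega> (\<kappa> (L2_proj (lebesgue_on \<Omega>) \<phi> \<theta>)) \<phi>)) \<and>
     \<S>\<^sub>h = discrete_solution \<Omega> \<Gamma>\<^sub>\<eta> \<kappa> \<phi> \<and>
     \<comment> \<open>network\<close>
     range X \<subseteq> \<Omega> \<and> range Xb \<subseteq> \<Gamma>\<^sub>\<eta> \<and>
     (\<forall>i. \<tau> i \<in> L2 (lebesgue_on \<Omega>)) \<and> NN = varmion D A A' \<tau> \<and>
     \<comment> \<open>output quadrature and training samples\<close>
     1 \<le> L \<and> (\<forall>l\<in>{1..L}. x l \<in> \<Omega>) \<and>
     (\<forall>g\<in>L2 (lebesgue_on \<Omega>).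
        \<bar>(\<Sum>l=1..L. w l * (g (x l))\<^sup>2) - (LINT y|lebesgue_on \<Omega>. (g y)\<^sup>2)\<bar> \<le> CQ g / real L powr \<gamma>) \<and>
     1 \<le> J \<and> (\<forall>j\<in>{1..J}. s j \<in> \<X>) \<and>
     err = (\<lambda>j y. \<S>\<^sub>h (data_proj \<Omega> \<Gamma>\<^sub>\<eta> \<phi> (s j)) y - NN (sensing X Xb (s j)) y) \<and>
     \<comment> \<open>(1) stability of the solution operator\<close>
     (\<forall>(f, \<theta>, \<eta>)\<in>\<X>. \<forall>(f', \<theta>', \<eta>')\<in>\<X>.
        L2_dist (lebesgue_on \<Omega>) (\<S> (f, \<theta>, \<eta>)) (\<S> (f', \<theta>', \<eta>'))
        \<le> Cstab * (L2_dist (lebesgue_on \<Omega>) f f' + L2_dist (lebesgue_on \<Omega>) \<theta> \<theta>'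
                    + L2_dist (surface_on \<Gamma>\<^sub>\<eta>) \<eta> \<eta>')) \<and>
     \<comment> \<open>(2) numerical error\<close>
     \<epsilon>\<^sub>h > 0 \<and>
     (\<forall>d\<in>\<X>. L2_dist (lebesgue_on \<Omega>) (\<S> d) (\<S>\<^sub>h (data_proj \<Omega> \<Gamma>\<^sub>\<eta> \<phi> d)) < C\<^sub>h d * \<epsilon>\<^sub>h) \<and>
     ChS = Max ((\<lambda>j. C\<^sub>h (s j)) ` {1..J}) \<and>
     \<comment> \<open>(3) covering\<close>
     compactin (data_topology \<Omega> \<Gamma>\<^sub>\<eta>) \<X> \<and> \<epsilon>\<^sub>s > 0 \<and>
     (\<forall>(f, \<theta>, \<eta>)\<in>\<X>. \<exists>j\<in>{1..J}. case s j of (f\<^sub>j, \<theta>\<^sub>j, \<eta>\<^sub>j) \<Rightarrow>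
        L2_dist (lebesgue_on \<Omega>) f f\<^sub>j < \<epsilon>\<^sub>s \<and> L2_dist (lebesgue_on \<Omega>) \<theta> \<theta>\<^sub>j < \<epsilon>\<^sub>s \<and>
        L2_dist (surface_on \<Gamma>\<^sub>\<eta>) \<eta> \<eta>\<^sub>j < \<epsilon>\<^sub>s) \<and>
     \<comment> \<open>(4) training\<close>
     \<epsilon>\<^sub>t > 0 \<and> (\<forall>j\<in>{1..J}. (\<Sum>l=1..L. w l * (err j (x l))\<^sup>2) < \<epsilon>\<^sub>t) \<and>
     \<comment> \<open>(5) boundedness and Lipschitz network\<close>
     (\<forall>f\<in>\<F>. Linf_norm (lebesgue_on \<Omega>) f \<le> ereal C\<^sub>F) \<and>
     (\<forall>\<theta>\<in>\<T>. Linf_norm (lebesgue_on \<Omega>) \<theta> \<le> ereal C\<^sub>T) \<and>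
     (\<forall>\<eta>\<in>\<N>. Linf_norm (surface_on \<Gamma>\<^sub>\<eta>) \<eta> \<le> ereal C\<^sub>N) \<and>
     C\<^sub>A > 0 \<and> C\<^sub>A' > 0 \<and> C\<^sub>\<tau> > 0 \<and> spectral_norm A \<le> C\<^sub>A \<and> spectral_norm A' \<le> C\<^sub>A' \<and>
     L2_set (\<lambda>i. L2_norm (lebesgue_on \<Omega>) (\<tau> i)) UNIV \<le> C\<^sub>\<tau> \<and>
     (\<forall>\<Theta>\<in>sense X ` \<T>. \<forall>\<Theta>'\<in>sense X ` \<T>.
        spectral_norm (D \<Theta> - D \<Theta>') \<le> L\<^sub>D * norm (\<Theta> - \<Theta>')) \<and>
     \<Theta>\<^sub>0 \<in> sense X ` \<T> \<and> spectral_norm (D \<Theta>\<^sub>0) \<le> C\<^sub>D \<and>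
     \<comment> \<open>(6) sensor quadrature\<close>
     (\<forall>i. w\<^sub>s $ i > 0) \<and> (\<forall>i. wb\<^sub>s $ i > 0) \<and>
     (\<forall>g\<in>L2 (lebesgue_on \<Omega>).
        \<bar>(\<Sum>i\<in>UNIV. w\<^sub>s $ i * (g (X i))\<^sup>2) - (LINT y|lebesgue_on \<Omega>. (g y)\<^sup>2)\<bar>
        \<le> CsQ g / real CARD('k) powr \<alpha>) \<and>
     (\<forall>g\<in>L2 (surface_on \<Gamma>\<^sub>\<eta>).
        \<bar>(\<Sum>i\<in>UNIV. wb\<^sub>s $ i * (g (Xb i))\<^sup>2) - (LINT y|surface_on \<Gamma>\<^sub>\<eta>. (g y)\<^sup>2)\<bar>
        \<le> CbQ g / real CARD('kb) powr \<alpha>') \<and>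
     bdd_above ((\<lambda>(f, f'). CsQ (\<lambda>y. f y - f' y)) ` (\<F> \<times> \<F>)) \<and>
     bdd_above ((\<lambda>(\<theta>, \<theta>'). CsQ (\<lambda>y. \<theta> y - \<theta>' y)) ` (\<T> \<times> \<T>)) \<and>
     bdd_above ((\<lambda>(\<eta>, \<eta>'). CbQ (\<lambda>y. \<eta> y - \<eta>' y)) ` (\<N> \<times> \<N>)) \<and>
     CQF = (SUP (f, f')\<in>\<F> \<times> \<F>. CsQ (\<lambda>y. f y - f' y)) \<and>
     CQT = (SUP (\<theta>, \<theta>')\<in>\<T> \<times> \<T>. CsQ (\<lambda>y. \<theta> y - \<theta>' y)) \<and>
     CQN = (SUP (\<eta>, \<eta>')\<in>\<N> \<times> \<N>. CbQ (\<lambda>y. \<eta> y - \<eta>' y)) \<and>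
     \<comment> \<open>constant of the output quadrature on the training errors\<close>
     CQS = Max ((\<lambda>j. CQ (err j)) ` {1..J}) \<and>
     \<comment> \<open>stability constant of the network\<close>
     Cnet = Cstab_net C\<^sub>F C\<^sub>T C\<^sub>N C\<^sub>A C\<^sub>A' C\<^sub>\<tau> CARD('k) CARD('kb) L\<^sub>D C\<^sub>D
     \<longrightarrow>
     network_stable \<Omega> X Xb NN \<X> Cnet \<and>
     (\<forall>d\<in>\<X>. L2_dist (lebesgue_on \<Omega>) (\<S> d) (NN (sensing X Xb d))
        \<le> ChS * \<epsilon>\<^sub>h
          + CS_bar Cstab Cnet w\<^sub>s wb\<^sub>s CQF CQT CQN * \<epsilon>\<^sub>s
          + sqrt \<epsilon>\<^sub>t
          + CQ_bar Cstab Cnet w\<^sub>s wb\<^sub>s CQF CQT CQN CQS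
            * (1 / real CARD('k) powr (\<alpha> / 2) + 1 / real CARD('kb) powr (\<alpha>' / 2)
               + 1 / real L powr (\<gamma> / 2)))"
\<comment> \<open>The three functions are fixed before the domain, the data and the network, so the
  resulting constants depend on these only through the listed arguments.\<close>
proof (rule exI[of _ network_constant], rule exI[of _ covering_constant],
    rule exI[of _ quadrature_constant], intro allI impI, elim conjE, goal_cases)
  case hyps: (1 \<Omega> \<Gamma>\<^sub>g \<Gamma>\<^sub>\<eta> \<F> \<T> \<N> \<X> \<kappa> \<S> \<phi> \<S>\<^sub>h X Xb w\<^sub>s wb\<^sub>s D A A' \<tau> NN L x w CQ \<gamma> J s err
    Cstab C\<^sub>h \<epsilon>\<^sub>h \<epsilon>\<^sub>s \<epsilon>\<^sub>t C\<^sub>F C\<^sub>T C\<^sub>N C\<^sub>A C\<^sub>A' C\<^sub>\<tau> L\<^sub>D \<Theta>\<^sub>0 C\<^sub>D CsQ CbQ \<alpha> \<alpha>' CQF CQT CQN CQS ChS Cnet)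
  note \<X> = \<open>\<X> = \<F> \<times> \<T> \<times> \<N>\<close>
  have dom: "open \<Omega>" "piecewise_smooth \<Gamma>\<^sub>\<eta>"
    using \<open>domain_with_boundary \<Omega> \<Gamma>\<^sub>g \<Gamma>\<^sub>\<eta>\<close> by (auto simp: domain_with_boundary_def)
  have cont: "f \<in> \<F> \<Longrightarrow> continuous_on \<Omega> f" "f \<in> \<T> \<Longrightarrow> continuous_on \<Omega> f"
    "f \<in> \<N> \<Longrightarrow> continuous_on \<Gamma>\<^sub>\<eta> f" for f
    using \<open>data_spaces \<Omega> \<Gamma>\<^sub>\<eta> \<F> \<T> \<N>\<close> closure_subset[of \<Omega>]
    by (auto simp: data_spaces_def intro: continuous_on_subset)
  have nodes: "X i \<in> \<Omega>" "Xb i' \<in> \<Gamma>\<^sub>\<eta>" for i i'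
    using \<open>range X \<subseteq> \<Omega>\<close> \<open>range Xb \<subseteq> \<Gamma>\<^sub>\<eta>\<close> by auto
  \<comment> \<open>The essential bounds become bounds at the nodes through continuity: on the open
    domain for \<open>\<F>\<close> and \<open>\<T>\<close>, on the piecewise smooth
    \<open>\<Gamma>\<^sub>\<eta>\<close> for \<open>\<N>\<close>.\<close>
  have net: "network_stable \<Omega> X Xb NN (\<F> \<times> \<T> \<times> \<N>) Cnet"
    unfolding \<open>NN = _\<close> \<open>Cnet = _\<close>
  proof (rule network_stable_varmion)
    show "\<bar>f (X i)\<bar> \<le> C\<^sub>F" if "f \<in> \<F>" for f i
      by (rule interior_value_le[OF dom(1) cont(1)[OF that] _ nodes(1)])
         (use that \<open>\<forall>f\<in>\<F>. Linf_norm _ f \<le> _\<close> in blast)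
    show "\<bar>\<theta> (X i)\<bar> \<le> C\<^sub>T" if "\<theta> \<in> \<T>" for \<theta> i
      by (rule interior_value_le[OF dom(1) cont(2)[OF that] _ nodes(1)])
         (use that \<open>\<forall>\<theta>\<in>\<T>. Linf_norm _ \<theta> \<le> _\<close> in blast)
    show "\<bar>\<eta> (Xb i)\<bar> \<le> C\<^sub>N" if "\<eta> \<in> \<N>" for \<eta> i
      by (rule boundary_value_le[OF dom(2) cont(3)[OF that] _ nodes(2)])
         (use that \<open>\<forall>\<eta>\<in>\<N>. Linf_norm _ \<eta> \<le> _\<close> in blast)
    show "\<tau> i \<in> L2 (lebesgue_on \<Omega>)" for i using \<open>\<forall>i. \<tau> i \<in> _\<close> by simp
    show "spectral_norm (D \<Theta> - D \<Theta>') \<le> L\<^sub>D * norm (\<Theta> - \<Theta>')"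
      if "\<Theta> \<in> sense X ` \<T>" "\<Theta>' \<in> sense X ` \<T>" for \<Theta> \<Theta>'
      using \<open>\<forall>\<Theta>\<in>_. \<forall>\<Theta>'\<in>_. spectral_norm (D \<Theta> - D \<Theta>') \<le> _\<close> that by blast
  qed (rule hyps)+
  show ?case
    unfolding \<X>
    by (intro conjI ballI net, rule generalization_error_le)
       (assumption | rule net hyps[unfolded \<X>])+
qed

end
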